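(* Let $0<\alpha<1$ and $\theta^2\le\varepsilon^2$. Let $0=t_0<t_1<\cdots<t_M=T$ be a time mesh with $\tau_n=t_n-t_{n-1}$, and let $(\phi^n,R^n)$ satisfy, for $n=0,1,\dots,M-1$, the $L1^+$-CN scheme $$\widehat L_l^\alpha\phi^{n+\frac12}-\varepsilon^2\frac{\Delta(\phi^{n+1}+\phi^n)}{2}+\Big(1-\frac{R^{n+1}+R^n}{2R^{n+\frac12}}\Big)\theta^2\Delta\phi^{n+\frac12}+\frac{R^{n+1}+R^n}{2R^{n+\frac12}}\Big(F'(\phi^{n+\frac12})+\widehat L_h^\alpha\phi^{n+\frac12}\Big)=0,$$ $$\frac{R^{n+1}-R^n}{\tau_{n+1}}=\frac{1}{2R^{n+\frac12}}\Big(-\theta^2\Delta\phi^{n+\frac12}+F'(\phi^{n+\frac12})+\widehat L_h^\alpha\phi^{n+\frac12},\ \frac{\phi^{n+1}-\phi^n}{\tau_{n+1}}\Big),$$ where $\phi^{n+\frac12}:=\phi^n+\frac{\tau_{n+1}}{2\tau_n}(\phi^n-\phi^{n-1})$ and $R^{n+\frac12}:=R^n+\frac{\tau_{n+1}}{2\tau_n}(R^n-R^{n-1})$, with periodic or Neumann boundary conditions on the $\phi^n$. Then for $n=0,1,\dots,M-1$, $$\frac{\varepsilon^2-\theta^2}{2}\|\nabla\phi^{n+1}\|_0^2+\frac{\theta^2}{4}\|\nabla(\phi^{n+1}-\phi^n)\|_0^2+|R^{n+1}|^2-\Big[\frac{\varepsilon^2-\theta^2}{2}\|\nabla\phi^n\|_0^2+\frac{\theta^2}{4}\Big(\frac{\tau_{n+1}}{\tau_n}\Big)^2\|\nabla(\phi^n-\phi^{n-1})\|_0^2+|R^n|^2\Big]\le-\frac{\widehat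 b_0}{\tau_{n+1}}\|\phi^{n+1}-\phi^n\|_0^2\le0 .$$ Consequently the scheme is unconditionally stable if the mesh is uniform ($\tau_{n+1}=\tau_n$ for all $n$) or if $\theta=0$; that is, in either case the discrete energy $\frac{\varepsilon^2-\theta^2}{2}\|\nabla\phi^{n+1}\|_0^2+\frac{\theta^2}{4}\|\nabla(\phi^{n+1}-\phi^n)\|_0^2+|R^{n+1}|^2$ is non-increasing in $n$.
   Context: The scheme is a time discretization (continuous in space) of the time fractional Allen–Cahn equation ${}_0D_t^\alpha\phi=\varepsilon^2\Delta\phi-F'(\phi)$ on a bounded domain $\Omega\subset\mathbb{R}^d$, $d\in\{1,2,3\}$, with periodic boundary conditions ($\Omega$ a box) or homogeneous Neumann boundary conditions, where $F:\mathbb{R}\to\mathbb{R}$ is a (differentiable) nonlinear potential and $\varepsilon,\theta$ are real constants. $(\cdot,\cdot)$ and $\|\cdot\|_0$ denote the $L^2(\Omega)$ inner product and norm. Each $\phi^n$ is a real-valued function on $\Omega$ satisfying the boundary condition, regular enough (e.g. $\phi^n\in H^2(\Omega)$, $F'(\phi^{n+\frac12})\in L^2(\Omega)$) for the scheme to hold in $L^2(\Omega)$ and for Green's formula $-(\Delta u,v)=(\nabla u,\nabla v)$ to apply without boundary terms; each $R^n$ is a real number (an auxiliary scalar variable), with $R^{n+\frac12}\neq0$. For $n=0$ the quantities $\phi^{-1}$, $R^{-1}$ and $\tau_0>0$ entering the extrapolations are arbitrary prescribed starting data ($\tau_0=\tau_1$ on a uniform mesh); $\phi^{-1}$ has the same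 regularity and boundary conditions as the other iterates. For each $n$, the $L1^+$ difference operators are $$\widehat L_l^\alpha\phi^{n+\frac12}=\widehat b_0\frac{\phi^{n+1}-\phi^n}{\tau_{n+1}},\qquad \widehat L_h^\alpha\phi^{n+\frac12}=\sum_{k=0}^{n-1}\widehat b_{n-k}\frac{\phi^{k+1}-\phi^k}{\tau_{k+1}}$$ (the empty sum for $n=0$ is $0$), with coefficients, depending on $n$, $$\widehat b_0=\frac{\tau_{n+1}^{1-\alpha}}{\Gamma(3-\alpha)},\qquad \widehat b_{n-k}=\frac{1}{\Gamma(1-\alpha)\,\tau_{n+1}}\int_{t_n}^{t_{n+1}}\int_{t_k}^{t_{k+1}}(t-s)^{-\alpha}\,ds\,dt,\quad k=0,\dots,n-1 .$$ *)

theory Defs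
  imports "HOL-Analysis.Analysis"
begin

section \<open>Square-integrable functions\<close>

definition in_L2 :: "'a::euclidean_space set \<Rightarrow> ('a \<Rightarrow> real) \<Rightarrow> bool" where
  "in_L2 \<Omega> u \<longleftrightarrow>
     u \<in> borel_measurable (lebesgue_on \<Omega>) \<and> integrable (lebesgue_on \<Omega>) (\<lambda>x. (u x)\<^sup>2)"

text \<open>The values are real-valued functions or, for gradients, vector fields.\<close>

definition L2_inner ::
  "'a::euclidean_space set \<Rightarrow> ('a \<Rightarrow> 'b::euclidean_space) \<Rightarrow> ('a \<Rightarrow> 'b) \<Rightarrow> real" where
  "L2_inner \<Omega> u v = integral\<^sup>L (lebesgue_on \<Omega>) (\<lambda>x. u x \<bullet> v x)"

definition L2_norm :: "'a::euclidean_space set \<Rightarrow> ('a \<Rightarrow> 'b::euclidean_space) \<Rightarrow> real" where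
  "L2_norm \<Omega> u = sqrt (L2_inner \<Omega> u u)"


section \<open>Weak derivatives and Sobolev spaces\<close>

abbreviation partial_deriv :: "'a::euclidean_space \<Rightarrow> ('a \<Rightarrow> real) \<Rightarrow> 'a \<Rightarrow> real" where
  "partial_deriv i f x \<equiv> frechet_derivative f (at x) i"

primrec Ck :: "nat \<Rightarrow> ('a::euclidean_space \<Rightarrow> real) \<Rightarrow> bool" where
  "Ck 0 f \<longleftrightarrow> continuous_on UNIV f"
| "Ck (Suc k) f \<longleftrightarrow>
     (\<forall>x. f differentiable (at x)) \<and> (\<forall>i\<in>Basis. Ck k (partial_deriv i f))"

definition smooth :: "('a::euclidean_space \<Rightarrow> real) \<Rightarrow> bool" where
  "smooth f \<longleftrightarrow> (\<forall>k. Ck k f)"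

definition test_function :: "'a::euclidean_space set \<Rightarrow> ('a \<Rightarrow> real) \<Rightarrow> bool" where
  "test_function \<Omega> \<psi> \<longleftrightarrow>
     smooth \<psi> \<and> compact (closure {x. \<psi> x \<noteq> 0}) \<and> closure {x. \<psi> x \<noteq> 0} \<subseteq> \<Omega>"

definition locally_integrable :: "'a::euclidean_space set \<Rightarrow> ('a \<Rightarrow> real) \<Rightarrow> bool" where
  "locally_integrable \<Omega> u \<longleftrightarrow> (\<forall>K. compact K \<and> K \<subseteq> \<Omega> \<longrightarrow> integrable (lebesgue_on K) u)"

definition has_weak_partial ::
  "'a::euclidean_space set \<Rightarrow> 'a \<Rightarrow> ('a \<Rightarrow> real) \<Rightarrow> ('a \<Rightarrow> real) \<Rightarrow> bool" where
  "has_weak_partial \<Omega> i u g \<longleftrightarrow>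
     locally_integrable \<Omega> u \<and> locally_integrable \<Omega> g \<and>
     (\<forall>\<psi>. test_function \<Omega> \<psi> \<longrightarrow> L2_inner \<Omega> u (partial_deriv i \<psi>) = - L2_inner \<Omega> g \<psi>)"

text \<open>
  Weak derivatives are determined only up to null sets; the following operators choose some
  representative. They are meant to be applied to functions whose weak derivatives exist, and to
  be used under an integral or an almost-everywhere quantifier.
\<close>

definition weak_partial ::
  "'a::euclidean_space set \<Rightarrow> 'a \<Rightarrow> ('a \<Rightarrow> real) \<Rightarrow> 'a \<Rightarrow> real" where
  "weak_partial \<Omega> i u = (SOME g. has_weak_partial \<Omega> i u g)"

definition weak_grad :: "'a::euclidean_space set \<Rightarrow> ('a \<Rightarrow> real) \<Rightarrow> 'a \<Rightarrow> 'a" where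
  "weak_grad \<Omega> u x = (\<Sum>i\<in>Basis. weak_partial \<Omega> i u x *\<^sub>R i)"

definition weak_laplacian :: "'a::euclidean_space set \<Rightarrow> ('a \<Rightarrow> real) \<Rightarrow> 'a \<Rightarrow> real" where
  "weak_laplacian \<Omega> u x = (\<Sum>i\<in>Basis. weak_partial \<Omega> i (weak_partial \<Omega> i u) x)"

definition in_H1 :: "'a::euclidean_space set \<Rightarrow> ('a \<Rightarrow> real) \<Rightarrow> bool" where
  "in_H1 \<Omega> u \<longleftrightarrow> in_L2 \<Omega> u \<and> (\<forall>i\<in>Basis. \<exists>g. in_L2 \<Omega> g \<and> has_weak_partial \<Omega> i u g)"

definition in_H2 :: "'a::euclidean_space set \<Rightarrow> ('a \<Rightarrow> real) \<Rightarrow> bool" where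
  "in_H2 \<Omega> u \<longleftrightarrow> in_H1 \<Omega> u \<and> (\<forall>i\<in>Basis. in_H1 \<Omega> (weak_partial \<Omega> i u))"

definition H2_norm :: "'a::euclidean_space set \<Rightarrow> ('a \<Rightarrow> real) \<Rightarrow> real" where
  "H2_norm \<Omega> u = sqrt ((L2_norm \<Omega> u)\<^sup>2 + (\<Sum>i\<in>Basis. (L2_norm \<Omega> (weak_partial \<Omega> i u))\<^sup>2)
     + (\<Sum>i\<in>Basis. \<Sum>j\<in>Basis. (L2_norm \<Omega> (weak_partial \<Omega> j (weak_partial \<Omega> i u)))\<^sup>2))"


section \<open>Boundary conditions\<close>

text \<open>
  For the box with opposite corners \<open>a\<close> and \<open>b\<close>, the periodic \<open>H\<^sup>2\<close> functions are the closure,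
  in the \<open>H\<^sup>2\<close> norm, of the smooth functions that have period \<open>(b - a) \<bullet> i\<close> in direction \<open>i\<close>.
\<close>

definition periodic_bc :: "'a::euclidean_space \<Rightarrow> 'a \<Rightarrow> ('a \<Rightarrow> real) \<Rightarrow> bool" where
  "periodic_bc a b u \<longleftrightarrow>
     (\<exists>w. (\<forall>k::nat. smooth (w k) \<and>
              (\<forall>i\<in>Basis. \<forall>x. w k (x + ((b - a) \<bullet> i) *\<^sub>R i) = w k x)) \<and>
          (\<lambda>k. H2_norm (box a b) (\<lambda>x. w k x - u x)) \<longlonglongrightarrow> 0)"

text \<open>
  The normal derivative of an \<open>H\<^sup>2\<close> function \<open>u\<close> on the boundary, as a functional of
  \<open>v \<in> H\<^sup>1(\<Omega>)\<close>: the pairing \<open>\<langle>\<partial>u/\<partial>\<nu>, v\<rangle> = (\<Delta>u, v) + (\<nabla>u, \<nabla>v)\<close>. On Lipschitz domains this is the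
  boundary integral of \<open>(\<partial>u/\<partial>\<nu>) v\<close>; on an arbitrary bounded domain, where a normal vector need not
  exist, it is the usual definition.
\<close>

definition normal_derivative ::
  "'a::euclidean_space set \<Rightarrow> ('a \<Rightarrow> real) \<Rightarrow> ('a \<Rightarrow> real) \<Rightarrow> real" where
  "normal_derivative \<Omega> u v =
     L2_inner \<Omega> (weak_laplacian \<Omega> u) v + L2_inner \<Omega> (weak_grad \<Omega> u) (weak_grad \<Omega> v)"

definition neumann_bc :: "'a::euclidean_space set \<Rightarrow> ('a \<Rightarrow> real) \<Rightarrow> bool" where
  "neumann_bc \<Omega> u \<longleftrightarrow> (\<forall>v. in_H1 \<Omega> v \<longrightarrow> normal_derivative \<Omega> u v = 0)"


section \<open>The time discretization\<close>

text \<open>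
  Sequences in time are indexed by integers, since the starting data carry the index \<open>-1\<close>.
  The operators below act on real sequences; for sequences of functions they are applied
  pointwise in space.
\<close>

definition bhat :: "real \<Rightarrow> (int \<Rightarrow> real) \<Rightarrow> (int \<Rightarrow> real) \<Rightarrow> int \<Rightarrow> int \<Rightarrow> real" where
  "bhat \<alpha> t \<tau> n j =
     (if j = 0 then \<tau> (n + 1) powr (1 - \<alpha>) / Gamma (3 - \<alpha>)
      else 1 / (Gamma (1 - \<alpha>) * \<tau> (n + 1)) *
        integral {t n..t (n + 1)}
          (\<lambda>r. integral {t (n - j)..t (n - j + 1)} (\<lambda>s. (r - s) powr (- \<alpha>))))"

definition L1plus_local ::
  "real \<Rightarrow> (int \<Rightarrow> real) \<Rightarrow> (int \<Rightarrow> real) \<Rightarrow> (int \<Rightarrow> real) \<Rightarrow> int \<Rightarrow> real" where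
  "L1plus_local \<alpha> t \<tau> f n = bhat \<alpha> t \<tau> n 0 * ((f (n + 1) - f n) / \<tau> (n + 1))"

definition L1plus_history ::
  "real \<Rightarrow> (int \<Rightarrow> real) \<Rightarrow> (int \<Rightarrow> real) \<Rightarrow> (int \<Rightarrow> real) \<Rightarrow> int \<Rightarrow> real" where
  "L1plus_history \<alpha> t \<tau> f n =
     (\<Sum>k\<in>{0..n - 1}. bhat \<alpha> t \<tau> n (n - k) * ((f (k + 1) - f k) / \<tau> (k + 1)))"

text \<open>The extrapolated value at index \<open>n + 1/2\<close>.\<close>

definition extrap :: "(int \<Rightarrow> real) \<Rightarrow> (int \<Rightarrow> real) \<Rightarrow> int \<Rightarrow> real" where
  "extrap \<tau> f n = f n + \<tau> (n + 1) / (2 * \<tau> n) * (f n - f (n - 1))"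

definition extrap_fun ::
  "(int \<Rightarrow> real) \<Rightarrow> (int \<Rightarrow> 'a \<Rightarrow> real) \<Rightarrow> int \<Rightarrow> 'a \<Rightarrow> real" where
  "extrap_fun \<tau> \<phi> n x = extrap \<tau> (\<lambda>m. \<phi> m x) n"

definition L1plus_CN_phi ::
  "'a::euclidean_space set \<Rightarrow> real \<Rightarrow> real \<Rightarrow> real \<Rightarrow> (real \<Rightarrow> real) \<Rightarrow> (int \<Rightarrow> real) \<Rightarrow>
    (int \<Rightarrow> real) \<Rightarrow> (int \<Rightarrow> 'a \<Rightarrow> real) \<Rightarrow> (int \<Rightarrow> real) \<Rightarrow> int \<Rightarrow> bool" where
  "L1plus_CN_phi \<Omega> \<alpha> \<epsilon> \<theta> F t \<tau> \<phi> R n \<longleftrightarrow>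
     (AE x in lebesgue_on \<Omega>.
        L1plus_local \<alpha> t \<tau> (\<lambda>m. \<phi> m x) n
        - \<epsilon>\<^sup>2 * (weak_laplacian \<Omega> (\<lambda>y. \<phi> (n + 1) y + \<phi> n y) x / 2)
        + (1 - (R (n + 1) + R n) / (2 * extrap \<tau> R n)) * \<theta>\<^sup>2
            * weak_laplacian \<Omega> (extrap_fun \<tau> \<phi> n) x
        + (R (n + 1) + R n) / (2 * extrap \<tau> R n)
            * (deriv F (extrap_fun \<tau> \<phi> n x) + L1plus_history \<alpha> t \<tau> (\<lambda>m. \<phi> m x) n)
        = 0)"

definition L1plus_CN_R ::
  "'a::euclidean_space set \<Rightarrow> real \<Rightarrow> real \<Rightarrow> (real \<Rightarrow> real) \<Rightarrow> (int \<Rightarrow> real) \<Rightarrow>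
    (int \<Rightarrow> real) \<Rightarrow> (int \<Rightarrow> 'a \<Rightarrow> real) \<Rightarrow> (int \<Rightarrow> real) \<Rightarrow> int \<Rightarrow> bool" where
  "L1plus_CN_R \<Omega> \<alpha> \<theta> F t \<tau> \<phi> R n \<longleftrightarrow>
     (R (n + 1) - R n) / \<tau> (n + 1) =
     1 / (2 * extrap \<tau> R n) *
       L2_inner \<Omega>
         (\<lambda>x. - \<theta>\<^sup>2 * weak_laplacian \<Omega> (extrap_fun \<tau> \<phi> n) x
               + deriv F (extrap_fun \<tau> \<phi> n x) + L1plus_history \<alpha> t \<tau> (\<lambda>m. \<phi> m x) n)
         (\<lambda>x. (\<phi> (n + 1) x - \<phi> n x) / \<tau> (n + 1))"

definition discrete_energy ::
  "'a::euclidean_space set \<Rightarrow> real \<Rightarrow> real \<Rightarrow> (int \<Rightarrow> 'a \<Rightarrow> real) \<Rightarrow> (int \<Rightarrow> real) \<Rightarrow> int \<Rightarrow> real" where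
  "discrete_energy \<Omega> \<epsilon> \<theta> \<phi> R n =
     (\<epsilon>\<^sup>2 - \<theta>\<^sup>2) / 2 * (L2_norm \<Omega> (weak_grad \<Omega> (\<phi> n)))\<^sup>2
     + \<theta>\<^sup>2 / 4 * (L2_norm \<Omega> (weak_grad \<Omega> (\<lambda>x. \<phi> n x - \<phi> (n - 1) x)))\<^sup>2
     + \<bar>R n\<bar>\<^sup>2"

end

theory Submission
  imports Defs
begin

text \<open>
  The extrapolated quantities enter the two equations of the scheme in matching ways: when the
  equation for \<open>\<phi>\<close> is tested with the increment \<open>\<phi>\<^sup>n\<^sup>+\<^sup>1 - \<phi>\<^sup>n\<close> and the equation for \<open>R\<close> is multiplied
  by \<open>(R\<^sup>n\<^sup>+\<^sup>1 + R\<^sup>n) \<tau>\<close>, the nonlinear term, the history term and the \<open>R\<close>-weighted part of the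
  stabilization cancel. What remains contains only \<open>R\<^sup>2\<close>, quadratic forms in the gradients of
  three consecutive iterates and the squared norm of the increment. Polarization and Young's
  inequality then give the estimate (\<open>energy_step\<close>). Its two brackets contain the same
  gradient-increment term when the step ratio is \<open>1\<close> or \<open>\<theta> = 0\<close>, and then the energy decreases.

  The analytic content lies in the two facts that this computation takes for granted.

  The first is that weak gradient and weak Laplacian are linear almost everywhere. They are chosen
  representatives, so this rests on uniqueness of weak derivatives, that is, on the fundamental lemma
  of the calculus of variations (\<open>AE_eq_0_if_orthogonal_to_test_functions\<close>). Its proof uses explicit
  smooth functions, built from \<open>exp (- 1 / x)\<close>, that converge to the indicator function of a box.

  The second is Green's formula without boundary terms, which says that the functional
  \<open>normal_derivative\<close> vanishes on all pairs of iterates. Under Neumann conditions this is the boundary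
  condition itself. For periodic functions (\<open>normal_derivative_periodic\<close>) it holds for smooth functions
  because the integral of a partial derivative of a periodic function over a period box is \<open>0\<close>
  (\<open>integral_partial_deriv_eq_0\<close>), and it passes to limits in the \<open>H\<^sup>2\<close> norm. That argument needs
  weak and classical derivatives of smooth functions to agree, which is integration by parts against
  a test function, obtained from the same lemma.
\<close>

section \<open>Calculus of smooth functions\<close>

lemma partial_deriv_eq:
  assumes "(f has_derivative f') (at x)"
  shows "partial_deriv i f x = f' i"
  using frechet_derivative_at[OF assms] by simp

text \<open>
  In the recursive definition of \<open>Ck\<close>, continuity of the function itself is demanded only at order
  zero; at higher orders it comes from differentiability. The product rule needs this, because it
  leaves one factor undifferentiated.
\<close>

lemma Ck_Suc_imp_Ck: "Ck (Suc k) f \<Longrightarrow> Ck k f"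
proof (induction k arbitrary: f)
  case 0
  then show ?case
    by (auto intro: differentiable_imp_continuous_on simp: differentiable_on_def differentiable_at_withinI)
next
  case (Suc k)
  then show ?case by simp
qed

lemma Ck_const: "Ck k (\<lambda>x. c)"
  by (induction k arbitrary: c) auto

lemma Ck_add:
  assumes "Ck k f" "Ck k g"
  shows "Ck k (\<lambda>x. f x + g x)"
  using assms
proof (induction k arbitrary: f g)
  case 0
  then show ?case by (simp add: continuous_on_add)
next
  case (Suc k)
  have "partial_deriv i (\<lambda>x. f x + g x) = (\<lambda>x. partial_deriv i f x + partial_deriv i g x)" for i
    using Suc.prems by (intro ext partial_deriv_eq)
      (auto simp: frechet_derivative_works intro!: has_derivative_add)
  with Suc show ?case by (auto intro!: differentiable_add)
qed

lemma partial_deriv_mult: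
  fixes f g :: "'a::euclidean_space \<Rightarrow> real"
  assumes "f differentiable (at x)" "g differentiable (at x)"
  shows "partial_deriv i (\<lambda>x. f x * g x) x = f x * partial_deriv i g x + partial_deriv i f x * g x"
  by (intro partial_deriv_eq[THEN trans])
     (use assms in \<open>auto simp: frechet_derivative_works intro!: has_derivative_mult\<close>)

lemma Ck_mult:
  assumes "Ck k f" "Ck k g"
  shows "Ck k (\<lambda>x. f x * g x)"
  using assms
proof (induction k arbitrary: f g)
  case 0
  then show ?case by (simp add: continuous_on_mult)
next
  case (Suc k)
  have "partial_deriv i (\<lambda>x. f x * g x)
      = (\<lambda>x. f x * partial_deriv i g x + partial_deriv i f x * g x)" for i
    using Suc.prems by (auto simp: partial_deriv_mult)
  moreover have "Ck k f" "Ck k g"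
    using Suc.prems by (auto intro: Ck_Suc_imp_Ck)
  ultimately show ?case
    using Suc by (auto intro!: Ck_add differentiable_mult)
qed

lemma Ck_prod:
  assumes "finite A" "\<And>a. a \<in> A \<Longrightarrow> Ck k (f a)"
  shows "Ck k (\<lambda>x. \<Prod>a\<in>A. f a x)"
  using assms by (induction A rule: finite_induct) (auto intro: Ck_const Ck_mult)

lemma smooth_imp_differentiable: "smooth f \<Longrightarrow> f differentiable (at x)"
  unfolding smooth_def by (metis Ck.simps(2))

lemma smooth_imp_continuous_on: "smooth f \<Longrightarrow> continuous_on S f"
  unfolding smooth_def by (metis Ck.simps(1) continuous_on_subset subset_UNIV)

lemma smooth_partial_deriv: "smooth f \<Longrightarrow> i \<in> Basis \<Longrightarrow> smooth (partial_deriv i f)"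
  unfolding smooth_def by (metis Ck.simps(2))

section \<open>Test functions that fill out a box\<close>

text \<open>
  For \<open>p = 1\<close> this is the classical smooth function that is flat at the origin. The
  polynomial factor makes the family closed under differentiation, so that smoothness of all its
  members follows from a single derivative.
\<close>

definition poly_exp :: "real poly \<Rightarrow> real \<Rightarrow> real" where
  "poly_exp p x = (if 0 < x then poly p (1 / x) * exp (- (1 / x)) else 0)"

text \<open>
  The limit at infinity that makes every function \<open>poly_exp p\<close> and its difference quotient tend to
  \<open>0\<close> at the origin.
\<close>

lemma poly_times_exp_minus_tendsto_0: "((\<lambda>y::real. poly p y * exp (- y)) \<longlongrightarrow> 0) at_top"
proof (induction p)
  case 0
  then show ?case by simp
next
  case (pCons a p)
  have "((\<lambda>y::real. poly p y * exp (- y) * y) \<longlongrightarrow> 0) at_top"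
  proof -
    have "((\<lambda>y. \<Sum>i\<le>degree p. coeff p i * (y ^ Suc i / exp y)) \<longlongrightarrow> (\<Sum>i\<le>degree p. coeff p i * 0)) at_top"
      by (intro tendsto_intros tendsto_power_div_exp_0)
    then show ?thesis
      by (simp add: poly_altdef sum_distrib_left sum_distrib_right exp_minus field_simps)
  qed
  moreover have "((\<lambda>y::real. a * (y ^ 0 / exp y)) \<longlongrightarrow> a * 0) at_top"
    by (intro tendsto_intros tendsto_power_div_exp_0)
  ultimately have "((\<lambda>y::real. a * (y ^ 0 / exp y) + poly p y * exp (- y) * y) \<longlongrightarrow> a * 0 + 0) at_top"
    by (intro tendsto_add)
  then show ?case
    by (simp add: algebra_simps exp_minus divide_inverse)
qed

text \<open>
  With \<open>y = 1 / x\<close> the chain rule gives the factor \<open>- y\<^sup>2\<close>, and differentiating \<open>p(y) exp(- y)\<close>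
  in \<open>y\<close> turns \<open>p\<close> into \<open>p' - p\<close>. At the origin, the difference quotient from the right is
  \<open>y p(y) exp(- y)\<close>, which vanishes in the limit.
\<close>

lemma poly_exp_deriv:
  "(poly_exp p has_field_derivative poly_exp ([:0, 0, 1:] * (p - pderiv p)) x) (at x)"
proof -
  consider "x < 0" | "x > 0" | "x = 0" by linarith
  then show ?thesis
  proof cases
    case 1
    have "((\<lambda>_. 0) has_field_derivative 0) (at x)" by simp
    then have "(poly_exp p has_field_derivative 0) (at x)"
      by (rule has_field_derivative_transform_within_open[of _ _ _ "{..<0}"])
         (use 1 in \<open>auto simp: poly_exp_def\<close>)
    with 1 show ?thesis by (simp add: poly_exp_def)
  next
    case 2
    have "((\<lambda>x. poly p (1 / x) * exp (- (1 / x))) has_field_derivative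
        poly ([:0, 0, 1:] * (p - pderiv p)) (1 / x) * exp (- (1 / x))) (at x)"
      using 2 by (auto intro!: derivative_eq_intros simp: field_simps power2_eq_square)
    then have "(poly_exp p has_field_derivative
        poly ([:0, 0, 1:] * (p - pderiv p)) (1 / x) * exp (- (1 / x))) (at x)"
      by (rule has_field_derivative_transform_within_open[of _ _ _ "{0<..}"])
         (use 2 in \<open>auto simp: poly_exp_def\<close>)
    with 2 show ?thesis by (simp add: poly_exp_def)
  next
    case 3
    have "((\<lambda>h. poly_exp p h / h) \<longlongrightarrow> 0) (at_left 0)"
      by (rule tendsto_eventually) (auto simp: eventually_at_filter poly_exp_def)
    moreover have "((\<lambda>h. poly_exp p h / h) \<longlongrightarrow> 0) (at_right 0)"
    proof -
      have "((\<lambda>h. poly (pCons 0 p) (inverse h) * exp (- (inverse h))) \<longlongrightarrow> 0) (at_right 0)"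
        by (rule filterlim_compose[OF poly_times_exp_minus_tendsto_0 filterlim_inverse_at_top_right])
      moreover have "\<forall>\<^sub>F h in at_right 0. poly (pCons 0 p) (inverse h) * exp (- (inverse h)) = poly_exp p h / h"
        by (auto simp: eventually_at_filter poly_exp_def field_simps)
      ultimately show ?thesis by (rule Lim_transform_eventually)
    qed
    ultimately have "((\<lambda>h. poly_exp p h / h) \<longlongrightarrow> 0) (at 0)"
      by (simp add: filterlim_split_at_real)
    with 3 show ?thesis
      by (simp add: has_field_derivative_iff poly_exp_def)
  qed
qed

lemma Ck_poly_exp_affine:
  "Ck k (\<lambda>x::'a::euclidean_space. poly_exp p (x \<bullet> v + c))"
proof (induction k arbitrary: p)
  case 0
  have "continuous_on UNIV (poly_exp p)"
    by (meson DERIV_isCont continuous_at_imp_continuous_on poly_exp_deriv)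
  then show ?case
    by (auto intro!: continuous_on_compose2[of UNIV "poly_exp p"] continuous_intros)
next
  case (Suc k)
  let ?q = "[:0, 0, 1:] * (p - pderiv p)"
  have D: "((\<lambda>x. poly_exp p (x \<bullet> v + c)) has_derivative (\<lambda>h. (h \<bullet> v) * poly_exp ?q (x \<bullet> v + c))) (at x)" for x
  proof -
    have "((\<lambda>x. x \<bullet> v + c) has_derivative (\<lambda>h. h \<bullet> v)) (at x)"
      by (auto intro!: derivative_eq_intros)
    from has_derivative_compose[OF this poly_exp_deriv[unfolded has_field_derivative_def]]
    show ?thesis by (simp add: mult.commute)
  qed
  have "partial_deriv i (\<lambda>x. poly_exp p (x \<bullet> v + c)) = (\<lambda>x. (i \<bullet> v) * poly_exp ?q (x \<bullet> v + c))" for i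
    using partial_deriv_eq[OF D] by blast
  then show ?case
    using D by (auto simp: differentiable_def intro!: Ck_mult Ck_const Suc.IH)
qed

text \<open>
  Each direction contributes two factors, which switch on at the two faces of the box; the factor
  \<open>k\<close> steepens the transition, so that the indicator function of the open box is the pointwise
  limit. The arguments are written as \<open>x \<bullet> v + c\<close> to make the factors instances of
  \<open>Ck_poly_exp_affine\<close>.
\<close>

definition box_bump :: "'a::euclidean_space \<Rightarrow> 'a \<Rightarrow> nat \<Rightarrow> 'a \<Rightarrow> real" where
  "box_bump a b k x = (\<Prod>i\<in>Basis. poly_exp 1 (x \<bullet> (real k *\<^sub>R i) - real k * (a \<bullet> i))
                                * poly_exp 1 (x \<bullet> (- (real k *\<^sub>R i)) + real k * (b \<bullet> i)))"

lemma smooth_box_bump: "smooth (box_bump a b k)"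
  unfolding smooth_def box_bump_def[abs_def] diff_conv_add_uminus
  by (intro allI Ck_prod Ck_mult Ck_poly_exp_affine) auto

lemma box_bump_range: "0 \<le> box_bump a b k x" "box_bump a b k x \<le> 1"
  unfolding box_bump_def
  by (auto intro!: prod_nonneg prod_le_1 mult_le_one simp: poly_exp_def)

lemma box_bump_eq_0: "x \<notin> box a b \<Longrightarrow> box_bump a b k x = 0"
proof -
  assume "x \<notin> box a b"
  then obtain i where i: "i \<in> Basis" "x \<bullet> i \<le> a \<bullet> i \<or> b \<bullet> i \<le> x \<bullet> i"
    by (auto simp: mem_box not_less)
  then have "x \<bullet> (real k *\<^sub>R i) - real k * (a \<bullet> i) \<le> 0 \<or> x \<bullet> (- (real k *\<^sub>R i)) + real k * (b \<bullet> i) \<le> 0"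
    by (auto simp: mult_left_mono)
  with i show ?thesis
    unfolding box_bump_def by (intro prod_zero) (auto simp: poly_exp_def intro!: bexI[of _ i])
qed

lemma box_bump_tendsto: "(\<lambda>k. box_bump a b k x) \<longlonglongrightarrow> indicator (box a b) x"
proof (cases "x \<in> box a b")
  case True
  have *: "(\<lambda>k. poly_exp 1 (real k * d)) \<longlonglongrightarrow> 1" if "d > 0" for d
  proof -
    have "(\<lambda>k. exp (- (inverse d * (1 / real k)))) \<longlonglongrightarrow> exp (- (inverse d * 0))"
      by (intro tendsto_intros lim_1_over_n)
    moreover have "\<forall>\<^sub>F k in sequentially. exp (- (inverse d * (1 / real k))) = poly_exp 1 (real k * d)"
      using eventually_gt_at_top[of 0] by eventually_elim (use that in \<open>auto simp: poly_exp_def field_simps\<close>)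
    ultimately show ?thesis by (auto intro: Lim_transform_eventually)
  qed
  have "(\<lambda>k. box_bump a b k x) \<longlonglongrightarrow> (\<Prod>i\<in>(Basis::'a set). 1 * 1)"
    unfolding box_bump_def
  proof (intro tendsto_prod tendsto_mult)
    fix i :: 'a assume i: "i \<in> Basis"
    show "(\<lambda>k. poly_exp 1 (x \<bullet> (real k *\<^sub>R i) - real k * (a \<bullet> i))) \<longlonglongrightarrow> 1"
      using *[of "x \<bullet> i - a \<bullet> i"] True i by (simp add: mem_box algebra_simps)
    show "(\<lambda>k. poly_exp 1 (x \<bullet> (- (real k *\<^sub>R i)) + real k * (b \<bullet> i))) \<longlonglongrightarrow> 1"
      using *[of "b \<bullet> i - x \<bullet> i"] True i by (simp add: mem_box algebra_simps)
  qed
  with True show ?thesis by simp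
qed (simp add: box_bump_eq_0)

lemma test_function_box_bump:
  assumes "cbox a b \<subseteq> \<Omega>"
  shows "test_function \<Omega> (box_bump a b k)"
proof -
  have "{x. box_bump a b k x \<noteq> 0} \<subseteq> cbox a b"
    using box_bump_eq_0[of _ a b k] box_subset_cbox by blast
  then have "closure {x. box_bump a b k x \<noteq> 0} \<subseteq> cbox a b"
    by (simp add: closure_minimal closed_cbox)
  then show ?thesis
    unfolding test_function_def using assms smooth_box_bump[of a b k]
    by (meson bounded_cbox bounded_subset closed_closure compact_eq_bounded_closed order_trans)
qed

section \<open>Integration over subsets\<close>

lemma lebesgue_compact [simp]: "compact (S::'a::euclidean_space set) \<Longrightarrow> S \<in> sets lebesgue"
  by (simp add: compact_imp_closed)

lemma borel_measurable_lebesgue_on_cong_AE: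
  fixes f g :: "'a::euclidean_space \<Rightarrow> real"
  assumes S: "S \<in> sets lebesgue" and f: "f \<in> borel_measurable (lebesgue_on S)"
    and eq: "AE x in lebesgue_on S. f x = g x"
  shows "g \<in> borel_measurable (lebesgue_on S)"
proof -
  have "(\<lambda>x. if x \<in> S then f x else 0) \<in> borel_measurable lebesgue"
    using f S by (simp add: borel_measurable_if)
  moreover have "AE x in lebesgue. (if x \<in> S then f x else 0) = (if x \<in> S then g x else 0)"
    using eq S by (auto simp: AE_restrict_space_iff)
  ultimately have "(\<lambda>x. if x \<in> S then g x else 0) \<in> borel_measurable lebesgue"
    by (rule borel_measurable_AE)
  with S show ?thesis by (simp add: borel_measurable_if)
qed

text \<open>
  Test functions live on a compact part of the domain; this is how integrals are moved between
  that part, the domain and an enclosing box.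
\<close>

lemma lebesgue_on_superset:
  fixes h :: "'a::euclidean_space \<Rightarrow> real"
  assumes "K \<subseteq> \<Omega>" "K \<in> sets lebesgue" "\<Omega> \<in> sets lebesgue" "\<And>x. x \<notin> K \<Longrightarrow> h x = 0"
  shows "integrable (lebesgue_on \<Omega>) h \<longleftrightarrow> integrable (lebesgue_on K) h"
    and "integral\<^sup>L (lebesgue_on \<Omega>) h = integral\<^sup>L (lebesgue_on K) h"
proof -
  have eq: "(\<lambda>x. if x \<in> \<Omega> then h x else 0) = (\<lambda>x. if x \<in> K then h x else 0)"
  proof
    fix x show "(if x \<in> \<Omega> then h x else 0) = (if x \<in> K then h x else 0)"
      using assms(1) assms(4)[of x] by auto
  qed
  show "integrable (lebesgue_on \<Omega>) h \<longleftrightarrow> integrable (lebesgue_on K) h"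
    using Lebesgue_Measure.integrable_restrict_UNIV[of \<Omega> h]
      Lebesgue_Measure.integrable_restrict_UNIV[of K h] assms eq by simp
  show "integral\<^sup>L (lebesgue_on \<Omega>) h = integral\<^sup>L (lebesgue_on K) h"
    using Lebesgue_Measure.integral_restrict_UNIV[of \<Omega> h] Lebesgue_Measure.integral_restrict_UNIV[of K h]
      assms eq by simp
qed

lemma integrable_lebesgue_on_subset:
  fixes h :: "'a::euclidean_space \<Rightarrow> real"
  assumes "K \<subseteq> \<Omega>" "K \<in> sets lebesgue" "\<Omega> \<in> sets lebesgue" "integrable (lebesgue_on \<Omega>) h"
  shows "integrable (lebesgue_on K) h"
proof -
  have "set_integrable lebesgue \<Omega> h"
    using assms by (simp add: set_integrable_def integrable_restrict_space)
  then have "set_integrable lebesgue K h"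
    using assms by (auto intro: set_integrable_subset)
  with assms show ?thesis by (simp add: set_integrable_def integrable_restrict_space)
qed

lemma integrable_mult_continuous_on_compact:
  fixes g \<psi> :: "'a::euclidean_space \<Rightarrow> real"
  assumes K: "compact K" and g: "integrable (lebesgue_on K) g" and c: "continuous_on K \<psi>"
  shows "integrable (lebesgue_on K) (\<lambda>x. g x * \<psi> x)"
proof -
  obtain B where B: "\<And>x. x \<in> K \<Longrightarrow> \<bar>\<psi> x\<bar> \<le> B"
    using compact_imp_bounded[OF compact_continuous_image[OF c K]]
    by (auto simp: bounded_iff)
  have m: "\<psi> \<in> borel_measurable (lebesgue_on K)"
    using c K by (simp add: continuous_imp_measurable_on_sets_lebesgue)
  show ?thesis
  proof (rule Bochner_Integration.integrable_bound[of _ "\<lambda>x. B * g x"])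
    show "AE x in lebesgue_on K. norm (g x * \<psi> x) \<le> norm (B * g x)"
    proof (rule AE_I2)
      fix x assume "x \<in> space (lebesgue_on K)"
      then have "\<bar>\<psi> x\<bar> \<le> \<bar>B\<bar>" using B[of x] by auto
      then show "norm (g x * \<psi> x) \<le> norm (B * g x)"
        by (simp add: abs_mult mult.commute mult_right_mono)
    qed
  qed (use g m in auto)
qed

lemma continuous_integrable_lebesgue_on_compact:
  fixes f :: "'a::euclidean_space \<Rightarrow> real"
  assumes "compact K" "continuous_on K f"
  shows "integrable (lebesgue_on K) f"
proof -
  have "finite_measure (lebesgue_on K)"
    using assms by (intro finite_measure_lebesgue_on lmeasurable_compact)
  then have "integrable (lebesgue_on K) (\<lambda>x. 1 * f x)"
    by (intro integrable_mult_continuous_on_compact assms finite_measure.integrable_const)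
  then show ?thesis by simp
qed

section \<open>Square-integrable functions\<close>

lemma in_L2_mult_integrable:
  assumes "in_L2 \<Omega> f" "in_L2 \<Omega> g"
  shows "integrable (lebesgue_on \<Omega>) (\<lambda>x. f x * g x)"
proof (rule Bochner_Integration.integrable_bound[of _ "\<lambda>x. (f x)\<^sup>2 + (g x)\<^sup>2"])
  show "AE x in lebesgue_on \<Omega>. norm (f x * g x) \<le> norm ((f x)\<^sup>2 + (g x)\<^sup>2)"
  proof (rule AE_I2)
    fix x
    show "norm (f x * g x) \<le> norm ((f x)\<^sup>2 + (g x)\<^sup>2)"
      using sum_squares_bound[of "\<bar>f x\<bar>" "\<bar>g x\<bar>"] abs_ge_zero[of "f x * g x"]
      unfolding abs_mult real_norm_def power2_abs by linarith
  qed
qed (use assms in \<open>auto simp: in_L2_def\<close>)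

lemma in_L2_lincomb:
  assumes "in_L2 \<Omega> f" "in_L2 \<Omega> g"
  shows "in_L2 \<Omega> (\<lambda>x. a * f x + b * g x)"
proof -
  have "(\<lambda>x. (a * f x + b * g x)\<^sup>2) = (\<lambda>x. a\<^sup>2 * (f x)\<^sup>2 + (2 * a * b) * (f x * g x) + b\<^sup>2 * (g x)\<^sup>2)"
    by (auto simp: power2_eq_square algebra_simps)
  moreover have "integrable (lebesgue_on \<Omega>) \<dots>"
    using assms in_L2_mult_integrable[OF assms] by (auto simp: in_L2_def)
  ultimately show ?thesis using assms by (auto simp: in_L2_def)
qed

lemma in_L2_zero: "in_L2 \<Omega> (\<lambda>x. 0)"
  by (simp add: in_L2_def)

lemma in_L2_scale: "in_L2 \<Omega> f \<Longrightarrow> in_L2 \<Omega> (\<lambda>x. a * f x)"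
  using in_L2_lincomb[OF _ in_L2_zero, of \<Omega> f a 0] by simp

lemma in_L2_add: "in_L2 \<Omega> f \<Longrightarrow> in_L2 \<Omega> g \<Longrightarrow> in_L2 \<Omega> (\<lambda>x. f x + g x)"
  using in_L2_lincomb[of \<Omega> f g 1 1] by simp

lemma in_L2_diff: "in_L2 \<Omega> f \<Longrightarrow> in_L2 \<Omega> g \<Longrightarrow> in_L2 \<Omega> (\<lambda>x. f x - g x)"
  using in_L2_lincomb[of \<Omega> f g 1 "-1"] by simp

lemma in_L2_sum:
  "(\<And>i. i \<in> I \<Longrightarrow> in_L2 \<Omega> (f i)) \<Longrightarrow> in_L2 \<Omega> (\<lambda>x. \<Sum>i\<in>I. f i x)"
  by (induction I rule: infinite_finite_induct) (auto intro: in_L2_zero in_L2_add)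

lemma in_L2_cong_AE:
  assumes "\<Omega> \<in> sets lebesgue" "in_L2 \<Omega> f" "AE x in lebesgue_on \<Omega>. f x = g x"
  shows "in_L2 \<Omega> g"
proof -
  have g: "g \<in> borel_measurable (lebesgue_on \<Omega>)"
    using assms borel_measurable_lebesgue_on_cong_AE by (auto simp: in_L2_def)
  have "integrable (lebesgue_on \<Omega>) (\<lambda>x. (g x)\<^sup>2)"
    by (rule integrable_cong_AE_imp[of _ "\<lambda>x. (f x)\<^sup>2"]) (use assms g in \<open>auto simp: in_L2_def\<close>)
  with g show ?thesis by (simp add: in_L2_def)
qed

lemma in_L2_imp_locally_integrable:
  assumes "open \<Omega>" "in_L2 \<Omega> u"
  shows "locally_integrable \<Omega> u"
  unfolding locally_integrable_def
proof (intro allI impI, elim conjE)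
  fix K assume K: "compact K" "K \<subseteq> \<Omega>"
  show "integrable (lebesgue_on K) u"
  proof (rule Bochner_Integration.integrable_bound[of _ "\<lambda>x. 1 + (u x)\<^sup>2"])
    have "finite_measure (lebesgue_on K)"
      using K by (intro finite_measure_lebesgue_on lmeasurable_compact)
    moreover have "integrable (lebesgue_on K) (\<lambda>x. (u x)\<^sup>2)"
      using K assms by (intro integrable_lebesgue_on_subset[of K \<Omega>]) (auto simp: in_L2_def)
    ultimately show "integrable (lebesgue_on K) (\<lambda>x. 1 + (u x)\<^sup>2)"
      by (auto intro: finite_measure.integrable_const)
    show "u \<in> borel_measurable (lebesgue_on K)"
      using assms K measurable_restrict_mono by (auto simp: in_L2_def)
    have "\<bar>y\<bar> \<le> \<bar>1 + y\<^sup>2\<bar>" for y :: real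
      using sum_squares_bound[of "\<bar>y\<bar>" 1] by simp
    then show "AE x in lebesgue_on K. norm (u x) \<le> norm (1 + (u x)\<^sup>2)" by simp
  qed
qed

lemma locally_integrable_lincomb:
  "locally_integrable \<Omega> u \<Longrightarrow> locally_integrable \<Omega> v \<Longrightarrow> locally_integrable \<Omega> (\<lambda>x. a * u x + b * v x)"
  by (auto simp: locally_integrable_def)

text \<open>
  The equality also holds where the products fail to be integrable: then both integrals have the
  default value \<open>0\<close>.
\<close>

lemma L2_inner_cong_AE:
  fixes u u' v v' :: "'a::euclidean_space \<Rightarrow> real"
  assumes "\<Omega> \<in> sets lebesgue" "AE x in lebesgue_on \<Omega>. u x = u' x" "AE x in lebesgue_on \<Omega>. v x = v' x"
  shows "L2_inner \<Omega> u v = L2_inner \<Omega> u' v'"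
proof -
  have ae: "AE x in lebesgue_on \<Omega>. u x * v x = u' x * v' x"
    using assms(2,3) by eventually_elim simp
  have ae': "AE x in lebesgue_on \<Omega>. u' x * v' x = u x * v x"
    using ae by eventually_elim simp
  have m: "(\<lambda>x. u x * v x) \<in> borel_measurable (lebesgue_on \<Omega>)
      \<longleftrightarrow> (\<lambda>x. u' x * v' x) \<in> borel_measurable (lebesgue_on \<Omega>)"
    using borel_measurable_lebesgue_on_cong_AE[OF assms(1) _ ae]
      borel_measurable_lebesgue_on_cong_AE[OF assms(1) _ ae'] by blast
  show ?thesis
  proof (cases "(\<lambda>x. u x * v x) \<in> borel_measurable (lebesgue_on \<Omega>)")
    case True
    then show ?thesis
      unfolding L2_inner_def inner_real_def using m ae by (intro integral_cong_AE) blast+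
  next
    case False
    with m have "\<not> integrable (lebesgue_on \<Omega>) (\<lambda>x. u x * v x)" "\<not> integrable (lebesgue_on \<Omega>) (\<lambda>x. u' x * v' x)"
      by auto
    then show ?thesis by (simp add: L2_inner_def not_integrable_integral_eq)
  qed
qed

lemma L2_inner_lincomb_left:
  fixes u v w :: "'a::euclidean_space \<Rightarrow> real"
  assumes "integrable (lebesgue_on \<Omega>) (\<lambda>x. u x * w x)" "integrable (lebesgue_on \<Omega>) (\<lambda>x. v x * w x)"
  shows "L2_inner \<Omega> (\<lambda>x. a * u x + b * v x) w = a * L2_inner \<Omega> u w + b * L2_inner \<Omega> v w"
  using assms by (simp add: L2_inner_def distrib_right mult.assoc)

lemma L2_inner_commute: "L2_inner \<Omega> u v = L2_inner \<Omega> v u"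
  by (simp add: L2_inner_def inner_commute)

lemma L2_norm_power2: "(L2_norm \<Omega> u)\<^sup>2 = L2_inner \<Omega> u u"
  unfolding L2_norm_def by (rule real_sqrt_pow2) (simp add: L2_inner_def)

text \<open>
  The quadratic form \<open>\<parallel>s f - r g\<parallel>\<^sup>2\<close> is nonnegative; it is evaluated at \<open>s = \<parallel>g\<parallel>\<^sup>2\<close> and
  \<open>r = (f, g)\<close>, or, if \<open>\<parallel>g\<parallel> = 0\<close>, at an \<open>r\<close> for which it would be \<open>-\<parallel>f\<parallel>\<^sup>2 - 2\<close>.
\<close>

lemma L2_Cauchy_Schwarz:
  assumes f: "in_L2 \<Omega> f" and g: "in_L2 \<Omega> g"
  shows "\<bar>L2_inner \<Omega> f g\<bar> \<le> L2_norm \<Omega> f * L2_norm \<Omega> g"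
proof -
  let ?A = "L2_inner \<Omega> f f" and ?B = "L2_inner \<Omega> g g" and ?C = "L2_inner \<Omega> f g"
  have pos: "0 \<le> s\<^sup>2 * ?A - 2 * s * r * ?C + r\<^sup>2 * ?B" for s r
  proof -
    let ?h = "\<lambda>x. s * f x + (- r) * g x"
    have h: "in_L2 \<Omega> ?h" using f g by (rule in_L2_lincomb)
    have "L2_inner \<Omega> ?h ?h = s * L2_inner \<Omega> f ?h + (- r) * L2_inner \<Omega> g ?h"
      using f g h by (intro L2_inner_lincomb_left in_L2_mult_integrable)
    also have "L2_inner \<Omega> f ?h = s * ?A + (- r) * L2_inner \<Omega> g f"
      unfolding L2_inner_commute[of _ f ?h] using f g by (intro L2_inner_lincomb_left in_L2_mult_integrable)
    also have "L2_inner \<Omega> g ?h = s * ?C + (- r) * ?B"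
      unfolding L2_inner_commute[of _ g ?h] using f g by (intro L2_inner_lincomb_left in_L2_mult_integrable)
    also have "L2_inner \<Omega> g f = ?C" by (rule L2_inner_commute)
    finally have "L2_inner \<Omega> ?h ?h = s\<^sup>2 * ?A - 2 * s * r * ?C + r\<^sup>2 * ?B"
      by (simp add: power2_eq_square algebra_simps)
    moreover have "0 \<le> L2_inner \<Omega> ?h ?h" unfolding L2_inner_def by simp
    ultimately show ?thesis by simp
  qed
  have B0: "0 \<le> ?B" unfolding L2_inner_def by simp
  have "?C\<^sup>2 \<le> ?A * ?B"
  proof (cases "?B = 0")
    case True
    have "?C = 0"
    proof (rule ccontr)
      assume "?C \<noteq> 0"
      then have "?A - 2 * ((?A + 1) / ?C) * ?C < 0"
        using pos[of 1 0] by simp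
      with pos[of 1 "(?A + 1) / ?C"] True show False by simp
    qed
    with True show ?thesis by simp
  next
    case False
    with B0 have "?B > 0" by simp
    moreover have "0 \<le> ?B * (?A * ?B - ?C\<^sup>2)"
      using pos[of ?B ?C] by (simp add: power2_eq_square algebra_simps)
    ultimately show ?thesis by (simp add: zero_le_mult_iff)
  qed
  then have "\<bar>?C\<bar> \<le> sqrt (?A * ?B)"
    by (metis real_sqrt_abs real_sqrt_le_iff)
  then show ?thesis by (simp add: L2_norm_def real_sqrt_mult)
qed

lemma L2_norm_nonneg: "0 \<le> L2_norm \<Omega> u"
  by (simp add: L2_norm_def L2_inner_def)

section \<open>The fundamental lemma of the calculus of variations\<close>

lemma test_functionD:
  assumes "test_function \<Omega> \<psi>"
  obtains K where "compact K" "K \<subseteq> \<Omega>" "\<And>x. x \<notin> K \<Longrightarrow> \<psi> x = 0"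
    "\<And>x i. x \<notin> K \<Longrightarrow> partial_deriv i \<psi> x = 0"
proof
  let ?K = "closure {x. \<psi> x \<noteq> 0}"
  show "compact ?K" "?K \<subseteq> \<Omega>" using assms by (auto simp: test_function_def)
  show 0: "\<psi> x = 0" if "x \<notin> ?K" for x
    using that closure_subset[of "{x. \<psi> x \<noteq> 0}"] by blast
  show "partial_deriv i \<psi> x = 0" if "x \<notin> ?K" for x i
  proof -
    have "((\<lambda>_. 0) has_derivative (\<lambda>_. 0)) (at x)" by simp
    then have "(\<psi> has_derivative (\<lambda>_. 0)) (at x)"
    proof (rule has_derivative_transform_within_open)
      show "open (- ?K)" "x \<in> - ?K" using that by auto
      show "0 = \<psi> y" if "y \<in> - ?K" for y using 0[of y] that by simp
    qed
    then show ?thesis by (rule partial_deriv_eq)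
  qed
qed

lemma locally_integrable_mult_test:
  assumes "open \<Omega>" "locally_integrable \<Omega> g" "test_function \<Omega> \<psi>"
  shows "integrable (lebesgue_on \<Omega>) (\<lambda>x. g x * \<psi> x)"
    and "i \<in> Basis \<Longrightarrow> integrable (lebesgue_on \<Omega>) (\<lambda>x. g x * partial_deriv i \<psi> x)"
proof -
  obtain K where K: "compact K" "K \<subseteq> \<Omega>" "\<And>x. x \<notin> K \<Longrightarrow> \<psi> x = 0"
    "\<And>x i. x \<notin> K \<Longrightarrow> partial_deriv i \<psi> x = 0"
    using test_functionD[OF assms(3)] by blast
  have s: "smooth \<psi>" using assms(3) by (simp add: test_function_def)
  have g: "integrable (lebesgue_on K) g"
    using assms(2) K by (simp add: locally_integrable_def)
  show "integrable (lebesgue_on \<Omega>) (\<lambda>x. g x * \<psi> x)"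
    by (subst lebesgue_on_superset(1)[OF K(2)])
       (use assms K g s in \<open>auto intro!: integrable_mult_continuous_on_compact smooth_imp_continuous_on\<close>)
  show "integrable (lebesgue_on \<Omega>) (\<lambda>x. g x * partial_deriv i \<psi> x)" if "i \<in> Basis"
    by (subst lebesgue_on_superset(1)[OF K(2)])
       (use assms K g s that in \<open>auto intro!: integrable_mult_continuous_on_compact
          smooth_imp_continuous_on smooth_partial_deriv\<close>)
qed

text \<open>
  Boxes are an intersection-stable generator of the Borel sets. The sets over which \<open>f\<close> has
  integral \<open>0\<close> are closed under complements, since the integral over the whole space is a limit of
  integrals over boxes, and under countable disjoint unions; hence they contain all Borel sets. A
  Borel representative is used because the generator yields Borel sets only.
\<close>

lemma AE_eq_0_if_box_integrals_0:
  fixes f :: "'a::euclidean_space \<Rightarrow> real"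
  assumes f: "integrable lebesgue f"
    and box: "\<And>l u. set_lebesgue_integral lebesgue (box l u) f = 0"
  shows "AE x in lebesgue. f x = 0"
proof -
  obtain h where h[measurable]: "h \<in> borel_measurable lborel" and fh: "AE x in lborel. f x = h x"
    using completion_ex_borel_measurable_real[of f lborel] f by auto
  have hm: "h \<in> borel_measurable lebesgue" using h by (rule measurable_completion)
  have ih: "integrable lborel h"
  proof -
    have "integrable lebesgue h"
      using integrable_cong_AE_imp[OF f hm] fh by (auto simp: AE_completion_iff)
    then show ?thesis by (simp add: integrable_completion)
  qed
  have sih: "set_integrable lborel A h" if "A \<in> sets borel" for A
    using set_integrable_subset[of lborel UNIV h A] ih that by (simp add: set_integrable_def)
  have box': "set_lebesgue_integral lborel (box l u) h = 0" for l u
  proof -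
    have "set_lebesgue_integral lborel (box l u) h = set_lebesgue_integral lebesgue (box l u) h"
      unfolding set_lebesgue_integral_def by (subst integral_completion) auto
    also have "\<dots> = set_lebesgue_integral lebesgue (box l u) f"
      unfolding set_lebesgue_integral_def real_scaleR_def
    proof (rule integral_cong_AE)
      have ind: "(indicator (box l u) :: 'a \<Rightarrow> real) \<in> borel_measurable lebesgue"
        by (rule borel_measurable_indicator) simp
      show "(\<lambda>x. indicator (box l u) x * h x) \<in> borel_measurable lebesgue"
        "(\<lambda>x. indicator (box l u) x * f x) \<in> borel_measurable lebesgue"
        using ind hm f by (auto intro: borel_measurable_times)
    qed (use fh in \<open>auto simp: AE_completion_iff\<close>)
    finally show ?thesis by (simp add: box)
  qed
  have univ: "set_lebesgue_integral lborel UNIV h = 0"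
  proof -
    let ?B = "\<lambda>n::nat. box (- (real n *\<^sub>R One)) (real n *\<^sub>R One) :: 'a set"
    have "(\<lambda>n. set_lebesgue_integral lborel (?B n) h) \<longlonglongrightarrow> set_lebesgue_integral lborel (\<Union>n. ?B n) h"
      by (intro set_integral_cont_up) (auto simp: incseq_def box_def intro!: sih)
    then show ?thesis
      unfolding box' UN_box_eq_UNIV by (simp add: LIMSEQ_const_iff)
  qed
  have "set_lebesgue_integral lborel A h = 0" if "A \<in> sets lborel" for A
  proof -
    have gen: "sets lborel = sigma_sets UNIV (range (\<lambda>(a, b). box a b::'a set))"
      by (simp add: borel_eq_box)
    have "Int_stable (range (\<lambda>(a, b). box a b::'a set))"
      by (auto simp: Int_stable_def box_Int_box)
    moreover have "range (\<lambda>(a, b). box a b::'a set) \<subseteq> Pow UNIV" by simp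
    moreover have "A \<in> sigma_sets UNIV (range (\<lambda>(a, b). box a b::'a set))"
      using that gen by simp
    ultimately show ?thesis
    proof (induction rule: sigma_sets_induct_disjoint)
      case (basic A)
      then show ?case using box' by auto
    next
      case empty
      then show ?case by (simp add: set_lebesgue_integral_def)
    next
      case (compl A)
      then have A: "A \<in> sets borel" using gen by simp
      have "set_lebesgue_integral lborel (A \<union> (UNIV - A)) h
          = set_lebesgue_integral lborel A h + set_lebesgue_integral lborel (UNIV - A) h"
        using A by (intro set_integral_Un sih) auto
      with compl univ show ?case by simp
    next
      case (union A)
      then have A: "A i \<in> sets borel" for i using gen by auto
      have "set_lebesgue_integral lborel (\<Union>i. A i) h = (\<Sum>i. set_lebesgue_integral lborel (A i) h)"
        using A union by (intro lebesgue_integral_countable_add sih) (auto simp: disjoint_family_on_def)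
      with union show ?case by simp
    qed
  qed
  then have "AE x in lborel. h x = 0"
    by (rule sigma_finite_measure.density_zero[OF sigma_finite_lborel ih])
  with fh have "AE x in lborel. f x = 0" by auto
  then show ?thesis by (rule AE_completion)
qed

text \<open>
  The functions \<open>box_bump\<close> converge boundedly to the indicator function of their box, so dominated
  convergence turns orthogonality to test functions into vanishing integrals over all boxes inside
  the domain. Countably many closed boxes exhaust the domain.
\<close>

lemma AE_eq_0_if_orthogonal_to_test_functions:
  fixes g :: "'a::euclidean_space \<Rightarrow> real"
  assumes "open \<Omega>" and g: "locally_integrable \<Omega> g"
    and 0: "\<And>\<psi>. test_function \<Omega> \<psi> \<Longrightarrow> L2_inner \<Omega> g \<psi> = 0"
  shows "AE x in lebesgue_on \<Omega>. g x = 0"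
proof -
  have box0: "integral\<^sup>L lebesgue (\<lambda>x. indicator (box a b) x * g x) = 0" if ab: "cbox a b \<subseteq> \<Omega>" for a b
  proof -
    let ?M = "lebesgue_on (cbox a b)"
    have ig: "integrable ?M g" using g ab by (auto simp: locally_integrable_def)
    have "(\<lambda>k. integral\<^sup>L ?M (\<lambda>x. g x * box_bump a b k x)) \<longlonglongrightarrow> integral\<^sup>L ?M (\<lambda>x. g x * indicator (box a b) x)"
    proof (rule integral_dominated_convergence[where w="\<lambda>x. norm (g x)"])
      show "AE x in ?M. (\<lambda>k. g x * box_bump a b k x) \<longlonglongrightarrow> g x * indicator (box a b) x"
        by (intro AE_I2 tendsto_mult tendsto_const box_bump_tendsto)
      show "AE x in ?M. norm (g x * box_bump a b k x) \<le> norm (g x)" for k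
        by (intro AE_I2) (auto simp: abs_mult abs_of_nonneg box_bump_range mult_left_le)
      have "box_bump a b k \<in> borel_measurable ?M" for k
        by (simp add: continuous_imp_measurable_on_sets_lebesgue smooth_box_bump smooth_imp_continuous_on)
      then show "(\<lambda>x. g x * box_bump a b k x) \<in> borel_measurable ?M" for k
        using ig by auto
      have "(indicator (box a b) :: 'a \<Rightarrow> real) \<in> borel_measurable ?M"
        by (intro measurable_restrict_space1 borel_measurable_indicator) simp
      then show "(\<lambda>x. g x * indicator (box a b) x) \<in> borel_measurable ?M"
        using ig by auto
    qed (use ig in auto)
    moreover have "integral\<^sup>L ?M (\<lambda>x. g x * box_bump a b k x) = 0" for k
    proof -
      have "integral\<^sup>L (lebesgue_on \<Omega>) (\<lambda>x. g x * box_bump a b k x) = integral\<^sup>L ?M (\<lambda>x. g x * box_bump a b k x)"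
      proof (rule lebesgue_on_superset(2))
        show "g x * box_bump a b k x = 0" if "x \<notin> cbox a b" for x
          using box_bump_eq_0[of x a b k] that box_subset_cbox[of a b] by (metis mult_zero_right subsetD)
      qed (use ab \<open>open \<Omega>\<close> in auto)
      with 0[OF test_function_box_bump[OF ab, of k]] show ?thesis
        by (simp add: L2_inner_def)
    qed
    ultimately have "integral\<^sup>L ?M (\<lambda>x. g x * indicator (box a b) x) = 0"
      by (simp add: LIMSEQ_const_iff)
    also have "integral\<^sup>L ?M (\<lambda>x. g x * indicator (box a b) x)
        = integral\<^sup>L (lebesgue_on UNIV) (\<lambda>x. g x * indicator (box a b) x)"
      using box_subset_cbox[of a b]
      by (intro lebesgue_on_superset(2)[symmetric]) (auto simp: indicator_def subset_iff)
    finally show ?thesis by (simp add: lebesgue_on_UNIV_eq mult.commute)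
  qed
  have on_cbox: "AE x in lebesgue. x \<in> cbox c d \<longrightarrow> g x = 0" if cd: "cbox c d \<subseteq> \<Omega>" for c d
  proof -
    let ?f = "\<lambda>x. indicator (box c d) x * g x"
    have "integrable (lebesgue_on (cbox c d)) g" using g cd by (auto simp: locally_integrable_def)
    then have "integrable (lebesgue_on (box c d)) g"
      using integrable_lebesgue_on_subset[OF box_subset_cbox] by auto
    then have "integrable lebesgue ?f"
      by (simp add: integrable_restrict_space)
    moreover have "set_lebesgue_integral lebesgue (box l u) ?f = 0" for l u
    proof -
      obtain a b where ab: "box l u \<inter> box c d = box a b"
        unfolding box_Int_box by blast
      have "set_lebesgue_integral lebesgue (box l u) ?f
          = integral\<^sup>L lebesgue (\<lambda>x. indicator (box a b) x * g x)"
        unfolding set_lebesgue_integral_def ab[symmetric]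
        by (simp add: indicator_inter_arith mult.assoc)
      also have "\<dots> = 0"
      proof (cases "box a b = {}")
        \<comment> \<open>The points \<open>a\<close> and \<open>b\<close> are known only through the open box that they span; when it is
          nonempty, its closure is the closed box with the same corners.\<close>
        case False
        then have "cbox a b = closure (box a b)" by (simp add: closure_box)
        also have "\<dots> \<subseteq> cbox c d"
          using ab box_subset_cbox[of c d] by (intro closure_minimal closed_cbox) blast
        finally show ?thesis using cd by (intro box0) auto
      qed simp
      finally show ?thesis .
    qed
    ultimately have "AE x in lebesgue. ?f x = 0"
      by (rule AE_eq_0_if_box_integrals_0)
    moreover have "AE x in lebesgue. x \<notin> cbox c d - box c d"
      using negligible_frontier_interval[of c d] by (intro AE_not_in) (simp add: negligible_iff_null_sets)
    ultimately show ?thesis by eventually_elim (auto simp: indicator_def)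
  qed
  obtain \<D> where D: "countable \<D>" "\<D> \<subseteq> Pow \<Omega>" "\<And>X. X \<in> \<D> \<Longrightarrow> \<exists>a b. X = cbox a b" "\<Union>\<D> = \<Omega>"
    using open_countable_Union_open_cbox[OF \<open>open \<Omega>\<close>] by metis
  have "AE x in lebesgue. \<forall>X\<in>\<D>. x \<in> X \<longrightarrow> g x = 0"
    unfolding AE_ball_countable[OF D(1)] using D(2,3) on_cbox by blast
  then have "AE x in lebesgue. x \<in> \<Omega> \<longrightarrow> g x = 0"
    by eventually_elim (use D(4) in blast)
  with \<open>open \<Omega>\<close> show ?thesis by (simp add: AE_restrict_space_iff)
qed

section \<open>Weak derivatives and their linearity\<close>

text \<open>
  The operators \<open>weak_partial\<close>, \<open>weak_grad\<close> and \<open>weak_laplacian\<close> select an arbitrary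
  representative. Uniqueness up to null sets is what makes them usable: it transfers integrability
  to the selected representative and makes the operators linear almost everywhere.
\<close>

lemma has_weak_partial_unique:
  assumes "open \<Omega>" "has_weak_partial \<Omega> i u g" "has_weak_partial \<Omega> i u h"
  shows "AE x in lebesgue_on \<Omega>. g x = h x"
proof -
  have l: "locally_integrable \<Omega> g" "locally_integrable \<Omega> h" using assms by (auto simp: has_weak_partial_def)
  have "AE x in lebesgue_on \<Omega>. 1 * g x + (- 1) * h x = 0"
  proof (rule AE_eq_0_if_orthogonal_to_test_functions[OF \<open>open \<Omega>\<close>])
    show "locally_integrable \<Omega> (\<lambda>x. 1 * g x + (- 1) * h x)"
      using l by (rule locally_integrable_lincomb)
    fix \<psi> assume t: "test_function \<Omega> \<psi>"
    with assms have "L2_inner \<Omega> g \<psi> = L2_inner \<Omega> h \<psi>"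
      by (simp add: has_weak_partial_def)
    then show "L2_inner \<Omega> (\<lambda>x. 1 * g x + (- 1) * h x) \<psi> = 0"
      by (subst L2_inner_lincomb_left) (use assms(1) l t in \<open>auto intro: locally_integrable_mult_test\<close>)
  qed
  then show ?thesis by simp
qed

lemma has_weak_partial_cong_AE:
  assumes "open \<Omega>" "has_weak_partial \<Omega> i u g" "locally_integrable \<Omega> v"
    "AE x in lebesgue_on \<Omega>. u x = v x"
  shows "has_weak_partial \<Omega> i v g"
  using assms L2_inner_cong_AE[of \<Omega> u v f f for f] by (simp add: has_weak_partial_def)

lemma has_weak_partial_lincomb:
  assumes "open \<Omega>" "i \<in> Basis" "has_weak_partial \<Omega> i u g" "has_weak_partial \<Omega> i v h"
  shows "has_weak_partial \<Omega> i (\<lambda>x. a * u x + b * v x) (\<lambda>x. a * g x + b * h x)"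
  using assms
  by (auto simp: has_weak_partial_def L2_inner_lincomb_left locally_integrable_mult_test
      intro!: locally_integrable_lincomb)

lemma weak_partial_AE_eq:
  assumes "open \<Omega>" "has_weak_partial \<Omega> i u g"
  shows "has_weak_partial \<Omega> i u (weak_partial \<Omega> i u)"
    and "AE x in lebesgue_on \<Omega>. weak_partial \<Omega> i u x = g x"
proof -
  show "has_weak_partial \<Omega> i u (weak_partial \<Omega> i u)"
    unfolding weak_partial_def using assms(2) by (rule someI[of "has_weak_partial \<Omega> i u"])
  then show "AE x in lebesgue_on \<Omega>. weak_partial \<Omega> i u x = g x"
    using assms has_weak_partial_unique by blast
qed

text \<open>
  The definition of \<open>in_H1\<close> provides some square-integrable weak derivative, which need not be the
  selected one; the two agree almost everywhere.
\<close>

lemma in_H1D: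
  assumes "open \<Omega>" "in_H1 \<Omega> u"
  shows "in_L2 \<Omega> u"
    and "i \<in> Basis \<Longrightarrow> has_weak_partial \<Omega> i u (weak_partial \<Omega> i u)"
    and "i \<in> Basis \<Longrightarrow> in_L2 \<Omega> (weak_partial \<Omega> i u)"
proof -
  show "in_L2 \<Omega> u" using assms by (simp add: in_H1_def)
  assume "i \<in> Basis"
  then obtain g where g: "in_L2 \<Omega> g" "has_weak_partial \<Omega> i u g"
    using assms by (auto simp: in_H1_def)
  show "has_weak_partial \<Omega> i u (weak_partial \<Omega> i u)"
    using weak_partial_AE_eq[OF assms(1) g(2)] by simp
  have "AE x in lebesgue_on \<Omega>. g x = weak_partial \<Omega> i u x"
    using weak_partial_AE_eq(2)[OF assms(1) g(2)] by eventually_elim simp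
  then show "in_L2 \<Omega> (weak_partial \<Omega> i u)"
    using in_L2_cong_AE[OF _ g(1)] assms(1) by auto
qed

lemma in_H1_cong_AE:
  assumes "open \<Omega>" "in_H1 \<Omega> u" "AE x in lebesgue_on \<Omega>. u x = v x"
  shows "in_H1 \<Omega> v"
proof -
  have "in_L2 \<Omega> v"
    using assms by (intro in_L2_cong_AE[OF _ in_H1D(1) assms(3)]) auto
  moreover have "has_weak_partial \<Omega> i v (weak_partial \<Omega> i u)" if "i \<in> Basis" for i
    by (rule has_weak_partial_cong_AE[OF assms(1) in_H1D(2)[OF assms(1,2) that] _ assms(3)])
       (rule in_L2_imp_locally_integrable[OF assms(1) \<open>in_L2 \<Omega> v\<close>])
  ultimately show ?thesis
    unfolding in_H1_def using in_H1D(3)[OF assms(1,2)] by auto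
qed

lemma in_H1_lincomb:
  assumes "open \<Omega>" "in_H1 \<Omega> u" "in_H1 \<Omega> v"
  shows "in_H1 \<Omega> (\<lambda>x. a * u x + b * v x)"
    and "i \<in> Basis \<Longrightarrow> AE x in lebesgue_on \<Omega>.
      weak_partial \<Omega> i (\<lambda>x. a * u x + b * v x) x = a * weak_partial \<Omega> i u x + b * weak_partial \<Omega> i v x"
proof -
  have *: "has_weak_partial \<Omega> i (\<lambda>x. a * u x + b * v x)
      (\<lambda>x. a * weak_partial \<Omega> i u x + b * weak_partial \<Omega> i v x)" if "i \<in> Basis" for i
    using that assms by (intro has_weak_partial_lincomb in_H1D(2))
  then show "i \<in> Basis \<Longrightarrow> AE x in lebesgue_on \<Omega>.
      weak_partial \<Omega> i (\<lambda>x. a * u x + b * v x) x = a * weak_partial \<Omega> i u x + b * weak_partial \<Omega> i v x"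
    using weak_partial_AE_eq(2)[OF assms(1)] by simp
  show "in_H1 \<Omega> (\<lambda>x. a * u x + b * v x)"
    unfolding in_H1_def
  proof (intro conjI ballI)
    show "in_L2 \<Omega> (\<lambda>x. a * u x + b * v x)"
      using assms by (intro in_L2_lincomb in_H1D(1))
    fix i :: 'a assume i: "i \<in> Basis"
    have "in_L2 \<Omega> (\<lambda>x. a * weak_partial \<Omega> i u x + b * weak_partial \<Omega> i v x)"
      using assms i by (intro in_L2_lincomb in_H1D(3))
    with *[OF i] show "\<exists>g. in_L2 \<Omega> g \<and> has_weak_partial \<Omega> i (\<lambda>x. a * u x + b * v x) g"
      by blast
  qed
qed

text \<open>
  The selected first derivative of a linear combination is only almost everywhere the linear
  combination of the selected first derivatives. Having a given weak derivative does not distinguish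
  the two, which makes the second derivatives linear as well.
\<close>

lemma in_H2_lincomb:
  assumes "open \<Omega>" "in_H2 \<Omega> u" "in_H2 \<Omega> v"
  shows "in_H2 \<Omega> (\<lambda>x. a * u x + b * v x)"
    and "AE x in lebesgue_on \<Omega>. weak_laplacian \<Omega> (\<lambda>x. a * u x + b * v x) x
        = a * weak_laplacian \<Omega> u x + b * weak_laplacian \<Omega> v x"
proof -
  let ?w = "\<lambda>x. a * u x + b * v x"
  let ?p = "\<lambda>i x. a * weak_partial \<Omega> i u x + b * weak_partial \<Omega> i v x"
  have H1: "in_H1 \<Omega> u" "in_H1 \<Omega> v" and H1p: "\<And>i. i \<in> Basis \<Longrightarrow> in_H1 \<Omega> (weak_partial \<Omega> i u)"
    "\<And>i. i \<in> Basis \<Longrightarrow> in_H1 \<Omega> (weak_partial \<Omega> i v)"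
    using assms by (auto simp: in_H2_def)
  have ae: "AE x in lebesgue_on \<Omega>. ?p i x = weak_partial \<Omega> i ?w x" if "i \<in> Basis" for i
    using in_H1_lincomb(2)[OF assms(1) H1 that, of a b] by eventually_elim simp
  have pH1: "in_H1 \<Omega> (?p i)" if "i \<in> Basis" for i
    using assms(1) H1p that by (intro in_H1_lincomb(1))
  have wH1: "in_H1 \<Omega> (weak_partial \<Omega> i ?w)" if "i \<in> Basis" for i
    by (rule in_H1_cong_AE[OF assms(1) pH1[OF that] ae[OF that]])
  then show "in_H2 \<Omega> ?w"
    using in_H1_lincomb(1)[OF assms(1) H1] by (simp add: in_H2_def)
  have second: "AE x in lebesgue_on \<Omega>. weak_partial \<Omega> i (weak_partial \<Omega> i ?w) x
        = a * weak_partial \<Omega> i (weak_partial \<Omega> i u) x + b * weak_partial \<Omega> i (weak_partial \<Omega> i v) x"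
    if "i \<in> Basis" for i
  proof -
    have "has_weak_partial \<Omega> i (?p i)
       (\<lambda>x. a * weak_partial \<Omega> i (weak_partial \<Omega> i u) x + b * weak_partial \<Omega> i (weak_partial \<Omega> i v) x)"
      using assms(1) that H1p by (intro has_weak_partial_lincomb in_H1D(2))
    moreover have "locally_integrable \<Omega> (weak_partial \<Omega> i ?w)"
      using wH1[OF that] assms(1) by (simp add: in_H1_def in_L2_imp_locally_integrable)
    ultimately show ?thesis
      by (intro weak_partial_AE_eq(2)[OF assms(1)] has_weak_partial_cong_AE[OF assms(1) _ _ ae[OF that]])
  qed
  have "AE x in lebesgue_on \<Omega>. \<forall>i\<in>Basis. weak_partial \<Omega> i (weak_partial \<Omega> i ?w) x
        = a * weak_partial \<Omega> i (weak_partial \<Omega> i u) x + b * weak_partial \<Omega> i (weak_partial \<Omega> i v) x"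
    by (rule AE_finite_allI) (auto intro: second)
  then show "AE x in lebesgue_on \<Omega>. weak_laplacian \<Omega> ?w x
        = a * weak_laplacian \<Omega> u x + b * weak_laplacian \<Omega> v x"
    by eventually_elim (simp add: weak_laplacian_def sum.distrib sum_distrib_left)
qed

lemma in_H2_laplacian_L2: "open \<Omega> \<Longrightarrow> in_H2 \<Omega> u \<Longrightarrow> in_L2 \<Omega> (weak_laplacian \<Omega> u)"
  unfolding weak_laplacian_def[abs_def] by (rule in_L2_sum) (auto simp: in_H2_def intro: in_H1D)

lemma L2_inner_weak_grad:
  assumes "open \<Omega>" "in_H1 \<Omega> u" "in_H1 \<Omega> v"
  shows "L2_inner \<Omega> (weak_grad \<Omega> u) (weak_grad \<Omega> v)
    = (\<Sum>i\<in>Basis. L2_inner \<Omega> (weak_partial \<Omega> i u) (weak_partial \<Omega> i v))"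
proof -
  have "L2_inner \<Omega> (weak_grad \<Omega> u) (weak_grad \<Omega> v)
     = integral\<^sup>L (lebesgue_on \<Omega>) (\<lambda>x. \<Sum>i\<in>Basis. weak_partial \<Omega> i u x * weak_partial \<Omega> i v x)"
    unfolding L2_inner_def weak_grad_def
    by (simp add: inner_sum_left inner_sum_right inner_Basis if_distrib mult.commute cong: if_cong)
  also have "\<dots> = (\<Sum>i\<in>Basis. L2_inner \<Omega> (weak_partial \<Omega> i u) (weak_partial \<Omega> i v))"
    unfolding L2_inner_def using assms
    by (subst Bochner_Integration.integral_sum) (auto intro!: in_L2_mult_integrable in_H1D(3))
  finally show ?thesis .
qed

lemma L2_inner_grad_lincomb_left:
  assumes "open \<Omega>" "in_H1 \<Omega> u" "in_H1 \<Omega> v" "in_H1 \<Omega> w"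
  shows "L2_inner \<Omega> (weak_grad \<Omega> (\<lambda>x. a * u x + b * v x)) (weak_grad \<Omega> w)
    = a * L2_inner \<Omega> (weak_grad \<Omega> u) (weak_grad \<Omega> w) + b * L2_inner \<Omega> (weak_grad \<Omega> v) (weak_grad \<Omega> w)"
proof -
  have "L2_inner \<Omega> (weak_partial \<Omega> i (\<lambda>x. a * u x + b * v x)) (weak_partial \<Omega> i w)
      = a * L2_inner \<Omega> (weak_partial \<Omega> i u) (weak_partial \<Omega> i w)
        + b * L2_inner \<Omega> (weak_partial \<Omega> i v) (weak_partial \<Omega> i w)" if "i \<in> Basis" for i
  proof -
    have "L2_inner \<Omega> (weak_partial \<Omega> i (\<lambda>x. a * u x + b * v x)) (weak_partial \<Omega> i w)
      = L2_inner \<Omega> (\<lambda>x. a * weak_partial \<Omega> i u x + b * weak_partial \<Omega> i v x) (weak_partial \<Omega> i w)"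
      using assms that by (intro L2_inner_cong_AE in_H1_lincomb(2)) auto
    also have "\<dots> = a * L2_inner \<Omega> (weak_partial \<Omega> i u) (weak_partial \<Omega> i w)
        + b * L2_inner \<Omega> (weak_partial \<Omega> i v) (weak_partial \<Omega> i w)"
      using assms that by (intro L2_inner_lincomb_left in_L2_mult_integrable in_H1D)
    finally show ?thesis .
  qed
  then show ?thesis
    using assms by (simp add: L2_inner_weak_grad in_H1_lincomb(1) sum.distrib sum_distrib_left)
qed

lemma normal_derivative_lincomb_left:
  assumes "open \<Omega>" "in_H2 \<Omega> u" "in_H2 \<Omega> v" "in_H1 \<Omega> w"
  shows "normal_derivative \<Omega> (\<lambda>x. a * u x + b * v x) w
    = a * normal_derivative \<Omega> u w + b * normal_derivative \<Omega> v w"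
proof -
  have "L2_inner \<Omega> (weak_laplacian \<Omega> (\<lambda>x. a * u x + b * v x)) w
      = L2_inner \<Omega> (\<lambda>x. a * weak_laplacian \<Omega> u x + b * weak_laplacian \<Omega> v x) w"
    using assms by (intro L2_inner_cong_AE in_H2_lincomb(2)) auto
  also have "\<dots> = a * L2_inner \<Omega> (weak_laplacian \<Omega> u) w + b * L2_inner \<Omega> (weak_laplacian \<Omega> v) w"
    using assms by (intro L2_inner_lincomb_left in_L2_mult_integrable in_H2_laplacian_L2 in_H1D(1))
  finally show ?thesis
    unfolding normal_derivative_def
    using assms by (simp add: L2_inner_grad_lincomb_left in_H2_def distrib_left)
qed

lemma normal_derivative_lincomb_right:
  assumes "open \<Omega>" "in_H2 \<Omega> u" "in_H1 \<Omega> v" "in_H1 \<Omega> w"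
  shows "normal_derivative \<Omega> u (\<lambda>x. a * v x + b * w x)
    = a * normal_derivative \<Omega> u v + b * normal_derivative \<Omega> u w"
proof -
  have "L2_inner \<Omega> (\<lambda>x. a * v x + b * w x) (weak_laplacian \<Omega> u)
      = a * L2_inner \<Omega> v (weak_laplacian \<Omega> u) + b * L2_inner \<Omega> w (weak_laplacian \<Omega> u)"
    using assms by (intro L2_inner_lincomb_left in_L2_mult_integrable in_H2_laplacian_L2 in_H1D(1))
  moreover have "L2_inner \<Omega> (weak_grad \<Omega> (\<lambda>x. a * v x + b * w x)) (weak_grad \<Omega> u)
    = a * L2_inner \<Omega> (weak_grad \<Omega> v) (weak_grad \<Omega> u) + b * L2_inner \<Omega> (weak_grad \<Omega> w) (weak_grad \<Omega> u)"
    using assms by (intro L2_inner_grad_lincomb_left) (auto simp: in_H2_def)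
  ultimately show ?thesis
    unfolding normal_derivative_def by (simp add: L2_inner_commute distrib_left)
qed

section \<open>Integration by parts for smooth functions\<close>

text \<open>
  Let \<open>G(s)\<close> be the integral over the box of \<open>f\<close> shifted by \<open>s\<close> in direction \<open>i\<close>. Differentiating
  under the integral, \<open>G'(0)\<close> is the integral of the partial derivative. For small \<open>s\<close>, the shifted
  box loses a slab of thickness \<open>s\<close> at its lower face and gains one at its upper face. Since \<open>f\<close>
  takes the same values on both slabs, \<open>G\<close> is constant on an interval to the right of \<open>0\<close>, and
  its one-sided derivative vanishes.

  The hypothesis concerns a slab and not the whole box, so that it covers both periodic functions and
  functions whose support stays away from the two faces.
\<close>

lemma integral_partial_deriv_eq_0:
  fixes f :: "'a::euclidean_space \<Rightarrow> real"
  assumes i: "i \<in> Basis" and f: "\<And>x. f differentiable (at x)"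
    and cont: "continuous_on UNIV (partial_deriv i f)"
    and \<delta>: "0 < \<delta>" "\<delta> \<le> (b - a) \<bullet> i"
    and per: "\<And>x. x \<in> cbox a b \<Longrightarrow> x \<bullet> i \<le> a \<bullet> i + \<delta> \<Longrightarrow> f (x + ((b - a) \<bullet> i) *\<^sub>R i) = f x"
  shows "integral (cbox a b) (partial_deriv i f) = 0"
proof -
  define L where "L = (b - a) \<bullet> i"
  define G where "G s = integral (cbox a b) (\<lambda>x. f (x + s *\<^sub>R i))" for s
  have cf: "continuous_on S f" for S
    using f by (meson differentiable_at_withinI differentiable_imp_continuous_on differentiable_on_def)
  have fint: "f integrable_on cbox c d" for c d
    by (rule integrable_continuous[OF cf])
  have const: "G s = G 0" if s: "s \<in> cbox 0 \<delta>" for s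
  proof -
    have s: "0 \<le> s" "s \<le> \<delta>" using s by auto
    let ?S = "\<lambda>v. cbox (a + v) (b + v)"
    \<comment> \<open>The slab gained at the upper face is the slab lost at the lower face, translated by \<open>L\<close>.\<close>
    have top: "?S (s *\<^sub>R i) \<inter> {x. x \<bullet> i \<ge> b \<bullet> i} = cbox (a + L *\<^sub>R i) (b - (L - s) *\<^sub>R i + L *\<^sub>R i)"
      and mid: "?S (s *\<^sub>R i) \<inter> {x. x \<bullet> i \<le> b \<bullet> i} = cbox a b \<inter> {x. x \<bullet> i \<ge> a \<bullet> i + s}"
      and bot: "cbox a b \<inter> {x. x \<bullet> i \<le> a \<bullet> i + s} = cbox a (b - (L - s) *\<^sub>R i)"
      using i s \<delta> unfolding set_eq_iff Int_iff mem_Collect_eq mem_box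
      by (force simp: L_def inner_simps inner_Basis split: if_splits)+
    have "integral (cbox (a + L *\<^sub>R i) (b - (L - s) *\<^sub>R i + L *\<^sub>R i)) f
        = integral (cbox a (b - (L - s) *\<^sub>R i)) (f \<circ> (+) (L *\<^sub>R i))"
      by (rule integral_shift_cbox_plus[symmetric])
    also have "\<dots> = integral (cbox a (b - (L - s) *\<^sub>R i)) f"
    proof (rule integral_cong)
      fix x assume "x \<in> cbox a (b - (L - s) *\<^sub>R i)"
      then have "x \<in> cbox a b" "x \<bullet> i \<le> a \<bullet> i + \<delta>"
        unfolding bot[symmetric] using s by auto
      then show "(f \<circ> (+) (L *\<^sub>R i)) x = f x"
        using per[of x] by (simp add: L_def add.commute)
    qed
    finally have slabs: "integral (cbox (a + L *\<^sub>R i) (b - (L - s) *\<^sub>R i + L *\<^sub>R i)) f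
      = integral (cbox a (b - (L - s) *\<^sub>R i)) f" .
    have "G s = integral (cbox a b) (f \<circ> (+) (s *\<^sub>R i))"
      by (simp add: G_def o_def add.commute)
    also have "\<dots> = integral (?S (s *\<^sub>R i)) f"
      by (rule integral_shift_cbox_plus)
    also have "\<dots> = integral (cbox a b \<inter> {x. x \<bullet> i \<ge> a \<bullet> i + s}) f
        + integral (cbox a b \<inter> {x. x \<bullet> i \<le> a \<bullet> i + s}) f"
      by (subst integral_split[OF fint i, of _ _ "b \<bullet> i"]) (simp only: top mid bot slabs)
    also have "\<dots> = integral (cbox a b) f"
      by (subst integral_split[OF fint i, of _ _ "a \<bullet> i + s"]) simp
    finally show ?thesis by (simp add: G_def)
  qed
  have "((\<lambda>s. integral (cbox a b) (\<lambda>x. f (x + s *\<^sub>R i))) has_vector_derivative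
      integral (cbox a b) (\<lambda>x. partial_deriv i f (x + 0 *\<^sub>R i))) (at 0 within cbox 0 \<delta>)"
  proof (rule leibniz_rule_vector_derivative)
    fix s x
    have F: "(f has_derivative frechet_derivative f (at (x + s *\<^sub>R i))) (at (x + s *\<^sub>R i))"
      using f frechet_derivative_works by blast
    have "((\<lambda>s. x + s *\<^sub>R i) has_derivative (\<lambda>h. h *\<^sub>R i)) (at s within cbox 0 \<delta>)"
      by (auto intro!: derivative_eq_intros)
    from has_derivative_compose[OF this F]
    show "((\<lambda>s. f (x + s *\<^sub>R i)) has_vector_derivative partial_deriv i f (x + s *\<^sub>R i))
        (at s within cbox 0 \<delta>)"
      by (simp add: has_vector_derivative_def linear_scale[OF has_derivative_linear[OF F]])
  next
    show "(\<lambda>x. f (x + s *\<^sub>R i)) integrable_on cbox a b" for s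
      by (intro integrable_continuous continuous_on_compose2[OF cf[of UNIV]] continuous_intros) auto
    show "continuous_on (cbox 0 \<delta> \<times> cbox a b) (\<lambda>(s, x). partial_deriv i f (x + s *\<^sub>R i))"
      unfolding case_prod_beta
      by (intro continuous_on_compose2[OF cont] continuous_intros) auto
  qed (use \<delta> in auto)
  then have "(G has_vector_derivative integral (cbox a b) (partial_deriv i f)) (at 0 within cbox 0 \<delta>)"
    by (simp add: G_def[abs_def])
  moreover have "(G has_vector_derivative 0) (at 0 within cbox 0 \<delta>)"
  proof (rule has_vector_derivative_weaken[OF has_vector_derivative_const[of "G 0"]])
    show "G 0 = G s" if "s \<in> cbox 0 \<delta>" for s using const[OF that] by (rule sym)
  qed (use \<delta> in auto)
  ultimately show ?thesis
    using \<delta> by (intro vector_derivative_unique_within_closed_interval[of 0 \<delta> 0 G]) auto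
qed

text \<open>
  The product of \<open>w\<close> with a test function is supported in a compact set. The auxiliary box
  reaches beyond this set by \<open>2\<close> in direction \<open>i\<close>, which leaves at the lower face a slab of
  thickness \<open>1\<close> where the product vanishes.
\<close>

lemma smooth_has_weak_partial:
  fixes w :: "'a::euclidean_space \<Rightarrow> real"
  assumes \<Omega>: "open \<Omega>" and i: "i \<in> Basis" and w: "smooth w"
  shows "has_weak_partial \<Omega> i w (partial_deriv i w)"
  unfolding has_weak_partial_def
proof (intro conjI allI impI)
  have pw: "smooth (partial_deriv i w)" using w i by (rule smooth_partial_deriv)
  show l: "locally_integrable \<Omega> w" "locally_integrable \<Omega> (partial_deriv i w)"
    using w pw unfolding locally_integrable_def
    by (auto intro: continuous_integrable_lebesgue_on_compact smooth_imp_continuous_on)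
  fix \<psi> assume t: "test_function \<Omega> \<psi>"
  then have \<psi>: "smooth \<psi>" by (simp add: test_function_def)
  obtain K where K: "compact K" "K \<subseteq> \<Omega>" "\<And>x. x \<notin> K \<Longrightarrow> \<psi> x = 0"
    "\<And>x i. x \<notin> K \<Longrightarrow> partial_deriv i \<psi> x = 0"
    using test_functionD[OF t] by blast
  define f where "f x = w x * \<psi> x" for x
  have df: "partial_deriv i f = (\<lambda>x. w x * partial_deriv i \<psi> x + partial_deriv i w x * \<psi> x)"
    unfolding f_def[abs_def] using w \<psi> by (auto simp: partial_deriv_mult smooth_imp_differentiable)
  have cf: "continuous_on S (partial_deriv i f)" for S
    unfolding df using w pw \<psi> smooth_partial_deriv[OF \<psi> i]
    by (intro continuous_intros smooth_imp_continuous_on)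
  have f0: "f x = 0" "partial_deriv i f x = 0" if "x \<notin> K" for x
    using K(3,4)[OF that] fun_cong[OF df, of x] by (simp_all add: f_def)
  \<comment> \<open>The origin is included so that \<open>c \<bullet> i\<close> is nonnegative even for empty \<open>K\<close>.\<close>
  obtain c where c: "K \<union> {0} \<subseteq> cbox (- c) c"
    using bounded_subset_cbox_symmetric[of "K \<union> {0}"] K(1) compact_imp_bounded by (metis bounded_Un bounded_insert bounded_empty)
  define a b where "a = - c - 2 *\<^sub>R i" and "b = c + 2 *\<^sub>R i"
  have "0 \<in> cbox (- c) c" using c by auto
  then have ci: "0 \<le> c \<bullet> i" using i by (auto simp: mem_box)
  have Ki: "\<bar>x \<bullet> i\<bar> \<le> c \<bullet> i" if "x \<in> K" for x
    using c that i by (force simp: mem_box abs_le_iff)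
  have Kab: "K \<subseteq> cbox a b"
  proof
    fix x assume "x \<in> K"
    then have "x \<in> cbox (- c) c" using c by auto
    then show "x \<in> cbox a b"
      using i unfolding a_def b_def mem_box by (force simp: inner_simps inner_Basis)
  qed
  have ii: "i \<bullet> i = 1" using i by simp
  have "integral (cbox a b) (partial_deriv i f) = 0"
  proof (rule integral_partial_deriv_eq_0[OF i _ cf, of 1])
    show "f differentiable at x" for x
      unfolding f_def using w \<psi> by (intro differentiable_mult smooth_imp_differentiable)
    show "1 \<le> (b - a) \<bullet> i" using ci ii by (simp add: a_def b_def inner_simps)
    fix x assume x: "x \<in> cbox a b" "x \<bullet> i \<le> a \<bullet> i + 1"
    have "a \<bullet> i \<le> x \<bullet> i" using x i by (auto simp: mem_box)
    then have "x \<notin> K" "x + ((b - a) \<bullet> i) *\<^sub>R i \<notin> K"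
      using x(2) Ki[of x] Ki[of "x + ((b - a) \<bullet> i) *\<^sub>R i"] ii by (auto simp: a_def b_def inner_simps)
    then show "f (x + ((b - a) \<bullet> i) *\<^sub>R i) = f x" by (simp add: f0)
  qed auto
  also have "integral (cbox a b) (partial_deriv i f) = integral\<^sup>L (lebesgue_on (cbox a b)) (partial_deriv i f)"
    by (intro lebesgue_integral_eq_integral[symmetric] continuous_integrable_lebesgue_on_compact cf) auto
  also have "\<dots> = integral\<^sup>L (lebesgue_on K) (partial_deriv i f)"
    using K Kab f0 by (intro lebesgue_on_superset(2)) auto
  also have "\<dots> = integral\<^sup>L (lebesgue_on \<Omega>) (partial_deriv i f)"
    using K \<Omega> f0 by (intro lebesgue_on_superset(2)[symmetric]) auto
  also have "\<dots> = L2_inner \<Omega> w (partial_deriv i \<psi>) + L2_inner \<Omega> (partial_deriv i w) \<psi>"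
    unfolding df L2_inner_def
    using locally_integrable_mult_test(2)[OF \<Omega> l(1) t i] locally_integrable_mult_test(1)[OF \<Omega> l(2) t]
    by simp
  finally show "L2_inner \<Omega> w (partial_deriv i \<psi>) = - L2_inner \<Omega> (partial_deriv i w) \<psi>" by simp
qed

lemma smooth_in_L2:
  fixes w :: "'a::euclidean_space \<Rightarrow> real"
  assumes "open \<Omega>" "bounded \<Omega>" "smooth w"
  shows "in_L2 \<Omega> w"
proof -
  have "integrable (lebesgue_on (closure \<Omega>)) (\<lambda>x. (w x)\<^sup>2)"
    using assms by (intro continuous_integrable_lebesgue_on_compact continuous_intros smooth_imp_continuous_on)
      (auto simp: compact_closure)
  then have "integrable (lebesgue_on \<Omega>) (\<lambda>x. (w x)\<^sup>2)"
    using assms by (intro integrable_lebesgue_on_subset[of \<Omega> "closure \<Omega>"]) (auto simp: closure_subset)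
  then show ?thesis
    using assms by (auto simp: in_L2_def continuous_imp_measurable_on_sets_lebesgue smooth_imp_continuous_on)
qed

lemma smooth_in_H2:
  fixes w :: "'a::euclidean_space \<Rightarrow> real"
  assumes \<Omega>: "open \<Omega>" "bounded \<Omega>" and w: "smooth w"
  shows "in_H2 \<Omega> w"
    and "i \<in> Basis \<Longrightarrow> AE x in lebesgue_on \<Omega>. weak_partial \<Omega> i w x = partial_deriv i w x"
    and "AE x in lebesgue_on \<Omega>. weak_laplacian \<Omega> w x = (\<Sum>i\<in>Basis. partial_deriv i (partial_deriv i w) x)"
proof -
  have H1: "in_H1 \<Omega> v" if "smooth v" for v :: "'a \<Rightarrow> real"
    unfolding in_H1_def using \<Omega> that by (meson smooth_has_weak_partial smooth_in_L2 smooth_partial_deriv)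
  have first: "AE x in lebesgue_on \<Omega>. partial_deriv i w x = weak_partial \<Omega> i w x" if "i \<in> Basis" for i
    using weak_partial_AE_eq(2)[OF \<Omega>(1) smooth_has_weak_partial[OF \<Omega>(1) that w]]
    by eventually_elim simp
  then show "i \<in> Basis \<Longrightarrow> AE x in lebesgue_on \<Omega>. weak_partial \<Omega> i w x = partial_deriv i w x"
    by (auto simp: eq_commute)
  have wH1: "in_H1 \<Omega> (weak_partial \<Omega> i w)" if "i \<in> Basis" for i
    by (rule in_H1_cong_AE[OF \<Omega>(1) H1[OF smooth_partial_deriv[OF w that]] first[OF that]])
  then show "in_H2 \<Omega> w" using H1[OF w] by (simp add: in_H2_def)
  have "AE x in lebesgue_on \<Omega>. weak_partial \<Omega> i (weak_partial \<Omega> i w) x = partial_deriv i (partial_deriv i w) x"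
    if i: "i \<in> Basis" for i
    using has_weak_partial_cong_AE[OF \<Omega>(1) smooth_has_weak_partial[OF \<Omega>(1) i smooth_partial_deriv[OF w i]]
        in_L2_imp_locally_integrable[OF \<Omega>(1) in_H1D(1)[OF \<Omega>(1) wH1[OF i]]] first[OF i]]
    by (rule weak_partial_AE_eq(2)[OF \<Omega>(1)])
  then have "AE x in lebesgue_on \<Omega>. \<forall>i\<in>Basis.
      weak_partial \<Omega> i (weak_partial \<Omega> i w) x = partial_deriv i (partial_deriv i w) x"
    by (intro AE_finite_allI) auto
  then show "AE x in lebesgue_on \<Omega>. weak_laplacian \<Omega> w x = (\<Sum>i\<in>Basis. partial_deriv i (partial_deriv i w) x)"
    by eventually_elim (simp add: weak_laplacian_def)
qed

section \<open>Green's formula for periodic functions\<close>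

lemma partial_deriv_periodic:
  fixes f :: "'a::euclidean_space \<Rightarrow> real"
  assumes f: "f differentiable (at (x + v))" and per: "\<And>x. f (x + v) = f x"
  shows "partial_deriv i f (x + v) = partial_deriv i f x"
proof -
  have F: "(f has_derivative frechet_derivative f (at (x + v))) (at (x + v))"
    using f frechet_derivative_works by blast
  have "((\<lambda>x. x + v) has_derivative (\<lambda>h. h)) (at x)"
    by (auto intro!: derivative_eq_intros)
  from has_derivative_compose[OF this F]
  have "(f has_derivative frechet_derivative f (at (x + v))) (at x)" by (simp add: per)
  from partial_deriv_eq[OF this, of i] show ?thesis by simp
qed

text \<open>
  \<open>\<partial>\<^sub>i(\<partial>\<^sub>iw z)\<close> is the derivative of a periodic function, so its integral over the box is \<open>0\<close>;
  summing over \<open>i\<close> gives the pairing of \<open>w\<close> and \<open>z\<close>.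
\<close>

lemma normal_derivative_smooth_periodic:
  fixes w z :: "'a::euclidean_space \<Rightarrow> real"
  assumes ne: "box a b \<noteq> {}" and w: "smooth w" and z: "smooth z"
    and perw: "\<And>i x. i \<in> Basis \<Longrightarrow> w (x + ((b - a) \<bullet> i) *\<^sub>R i) = w x"
    and perz: "\<And>i x. i \<in> Basis \<Longrightarrow> z (x + ((b - a) \<bullet> i) *\<^sub>R i) = z x"
  shows "normal_derivative (box a b) w z = 0"
proof -
  let ?\<Omega> = "box a b"
  have \<Omega>: "open ?\<Omega>" "bounded ?\<Omega>" by auto
  have pw: "smooth (partial_deriv i w)" "smooth (partial_deriv i (partial_deriv i w))"
    and pz: "smooth (partial_deriv i z)" if "i \<in> Basis" for i
    using w z that smooth_partial_deriv by blast+
  have int: "integrable (lebesgue_on ?\<Omega>) (\<lambda>x. f x * g x)" if "smooth f" "smooth g" for f g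
    using that \<Omega> by (intro in_L2_mult_integrable smooth_in_L2)
  have zero: "L2_inner ?\<Omega> (partial_deriv i (partial_deriv i w)) z
      + L2_inner ?\<Omega> (partial_deriv i w) (partial_deriv i z) = 0" if i: "i \<in> Basis" for i
  proof -
    define f where "f x = partial_deriv i w x * z x" for x
    have df: "partial_deriv i f = (\<lambda>x. partial_deriv i w x * partial_deriv i z x
        + partial_deriv i (partial_deriv i w) x * z x)"
      unfolding f_def[abs_def] using pw[OF i] z by (auto simp: partial_deriv_mult smooth_imp_differentiable)
    have Li: "(b - a) \<bullet> i > 0"
      using ne i by (auto simp: box_ne_empty inner_simps)
    have "integral (cbox a b) (partial_deriv i f) = 0"
    proof (rule integral_partial_deriv_eq_0[OF i _ _ Li order_refl])
      show "f differentiable at x" for x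
        unfolding f_def using pw[OF i] z by (intro differentiable_mult smooth_imp_differentiable)
      show "continuous_on UNIV (partial_deriv i f)"
        unfolding df using pw[OF i] pz[OF i] z by (intro continuous_intros smooth_imp_continuous_on)
      show "f (x + ((b - a) \<bullet> i) *\<^sub>R i) = f x" for x
        unfolding f_def
        by (simp add: perz i partial_deriv_periodic[OF smooth_imp_differentiable[OF w] perw[OF i]])
    qed
    also have "integral (cbox a b) (partial_deriv i f) = integral ?\<Omega> (partial_deriv i f)"
      by (rule integral_open_interval[symmetric])
    also have "\<dots> = integral\<^sup>L (lebesgue_on ?\<Omega>) (partial_deriv i f)"
      unfolding df using pw[OF i] pz[OF i] z
      by (intro lebesgue_integral_eq_integral[symmetric] Bochner_Integration.integrable_add int) auto
    also have "\<dots> = L2_inner ?\<Omega> (partial_deriv i w) (partial_deriv i z)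
        + L2_inner ?\<Omega> (partial_deriv i (partial_deriv i w)) z"
      unfolding df L2_inner_def inner_real_def using pw[OF i] pz[OF i] z
      by (intro Bochner_Integration.integral_add int)
    finally show ?thesis by simp
  qed
  have "L2_inner ?\<Omega> (weak_laplacian ?\<Omega> w) z
      = L2_inner ?\<Omega> (\<lambda>x. \<Sum>i\<in>Basis. partial_deriv i (partial_deriv i w) x) z"
    by (intro L2_inner_cong_AE smooth_in_H2(3)[OF \<Omega> w]) auto
  also have "\<dots> = (\<Sum>i\<in>Basis. L2_inner ?\<Omega> (partial_deriv i (partial_deriv i w)) z)"
    unfolding L2_inner_def inner_real_def sum_distrib_right
    using pw z by (intro Bochner_Integration.integral_sum int)
  finally have lap: "L2_inner ?\<Omega> (weak_laplacian ?\<Omega> w) z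
      = (\<Sum>i\<in>Basis. L2_inner ?\<Omega> (partial_deriv i (partial_deriv i w)) z)" .
  have "L2_inner ?\<Omega> (weak_grad ?\<Omega> w) (weak_grad ?\<Omega> z)
      = (\<Sum>i\<in>Basis. L2_inner ?\<Omega> (weak_partial ?\<Omega> i w) (weak_partial ?\<Omega> i z))"
    using smooth_in_H2(1)[OF \<Omega>] w z by (intro L2_inner_weak_grad \<Omega>) (auto simp: in_H2_def)
  also have "\<dots> = (\<Sum>i\<in>Basis. L2_inner ?\<Omega> (partial_deriv i w) (partial_deriv i z))"
    by (intro sum.cong refl L2_inner_cong_AE smooth_in_H2(2)[OF \<Omega>] w z) auto
  finally show ?thesis
    unfolding normal_derivative_def lap using zero by (simp flip: sum.distrib)
qed

lemma H2_norm_bounds: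
  shows "L2_norm \<Omega> u \<le> H2_norm \<Omega> u"
    and "i \<in> Basis \<Longrightarrow> L2_norm \<Omega> (weak_partial \<Omega> i u) \<le> H2_norm \<Omega> u"
    and "i \<in> Basis \<Longrightarrow> L2_norm \<Omega> (weak_partial \<Omega> i (weak_partial \<Omega> i u)) \<le> H2_norm \<Omega> u"
proof -
  let ?s1 = "\<Sum>i\<in>Basis. (L2_norm \<Omega> (weak_partial \<Omega> i u))\<^sup>2"
  let ?t = "\<lambda>i. \<Sum>j\<in>Basis. (L2_norm \<Omega> (weak_partial \<Omega> j (weak_partial \<Omega> i u)))\<^sup>2"
  have n: "0 \<le> ?s1" "0 \<le> sum ?t Basis" by (intro sum_nonneg; simp)+
  show "L2_norm \<Omega> u \<le> H2_norm \<Omega> u"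
    unfolding H2_norm_def using n by (intro real_le_rsqrt) simp
  assume i: "i \<in> Basis"
  have "(L2_norm \<Omega> (weak_partial \<Omega> i u))\<^sup>2 \<le> ?s1"
    using i by (intro member_le_sum) auto
  with n show "L2_norm \<Omega> (weak_partial \<Omega> i u) \<le> H2_norm \<Omega> u"
    unfolding H2_norm_def by (intro real_le_rsqrt) (simp add: add_increasing add_increasing2)
  have "(L2_norm \<Omega> (weak_partial \<Omega> i (weak_partial \<Omega> i u)))\<^sup>2 \<le> ?t i"
    using i by (intro member_le_sum[of i _ "\<lambda>j. (L2_norm \<Omega> (weak_partial \<Omega> j (weak_partial \<Omega> i u)))\<^sup>2"]) auto
  also have "?t i \<le> sum ?t Basis"
    using i by (intro member_le_sum[of i _ ?t]) (auto intro: sum_nonneg)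
  finally show "L2_norm \<Omega> (weak_partial \<Omega> i (weak_partial \<Omega> i u)) \<le> H2_norm \<Omega> u"
    unfolding H2_norm_def using n by (intro real_le_rsqrt) (simp add: add_increasing)
qed

lemma normal_derivative_bound:
  fixes u v :: "'a::euclidean_space \<Rightarrow> real"
  assumes \<Omega>: "open \<Omega>" and u: "in_H2 \<Omega> u" and v: "in_H2 \<Omega> v"
  shows "\<bar>normal_derivative \<Omega> u v\<bar> \<le> 2 * real DIM('a) * (H2_norm \<Omega> u * H2_norm \<Omega> v)"
proof -
  let ?p = "weak_partial \<Omega>"
  have L2: "in_L2 \<Omega> v" "\<And>i. i \<in> Basis \<Longrightarrow> in_L2 \<Omega> (?p i u)" "\<And>i. i \<in> Basis \<Longrightarrow> in_L2 \<Omega> (?p i v)"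
    "\<And>i. i \<in> Basis \<Longrightarrow> in_L2 \<Omega> (?p i (?p i u))"
    using in_H1D[OF \<Omega>] u v by (auto simp: in_H2_def)
  have "L2_inner \<Omega> (weak_laplacian \<Omega> u) v = (\<Sum>i\<in>Basis. L2_inner \<Omega> (?p i (?p i u)) v)"
    unfolding L2_inner_def inner_real_def weak_laplacian_def sum_distrib_right
    using L2 by (intro Bochner_Integration.integral_sum in_L2_mult_integrable)
  then have eq: "normal_derivative \<Omega> u v
      = (\<Sum>i\<in>Basis. L2_inner \<Omega> (?p i (?p i u)) v + L2_inner \<Omega> (?p i u) (?p i v))"
    unfolding normal_derivative_def using u v \<Omega> by (simp add: L2_inner_weak_grad in_H2_def sum.distrib)
  have prod: "\<bar>L2_inner \<Omega> f g\<bar> \<le> H2_norm \<Omega> u * H2_norm \<Omega> v"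
    if "in_L2 \<Omega> f" "in_L2 \<Omega> g" "L2_norm \<Omega> f \<le> H2_norm \<Omega> u" "L2_norm \<Omega> g \<le> H2_norm \<Omega> v" for f g
  proof -
    have "L2_norm \<Omega> f * L2_norm \<Omega> g \<le> H2_norm \<Omega> u * H2_norm \<Omega> v"
      using that L2_norm_nonneg by (intro mult_mono) (auto intro: order_trans)
    with L2_Cauchy_Schwarz[OF that(1,2)] show ?thesis by simp
  qed
  have "\<bar>normal_derivative \<Omega> u v\<bar>
      \<le> (\<Sum>i\<in>(Basis::'a set). 2 * (H2_norm \<Omega> u * H2_norm \<Omega> v))"
    unfolding eq
  proof (rule order_trans[OF sum_abs], rule sum_mono)
    fix i :: 'a assume i: "i \<in> Basis"
    have "\<bar>L2_inner \<Omega> (?p i (?p i u)) v\<bar> \<le> H2_norm \<Omega> u * H2_norm \<Omega> v"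
      "\<bar>L2_inner \<Omega> (?p i u) (?p i v)\<bar> \<le> H2_norm \<Omega> u * H2_norm \<Omega> v"
      using L2 i by (auto intro!: prod H2_norm_bounds)
    then show "\<bar>L2_inner \<Omega> (?p i (?p i u)) v + L2_inner \<Omega> (?p i u) (?p i v)\<bar>
        \<le> 2 * (H2_norm \<Omega> u * H2_norm \<Omega> v)" by linarith
  qed
  then show ?thesis by simp
qed

lemma eq_0_if_abs_le_null_sequence:
  fixes c :: real
  assumes "\<And>k. \<bar>c\<bar> \<le> D * e k" "e \<longlonglongrightarrow> 0"
  shows "c = 0"
proof -
  have "(\<lambda>k. D * e k) \<longlonglongrightarrow> D * 0" using assms(2) by (intro tendsto_intros)
  then have "\<bar>c\<bar> \<le> D * 0" by (rule LIMSEQ_le_const) (use assms(1) in auto)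
  then show ?thesis by simp
qed

text \<open>
  The pairing is continuous in the \<open>H\<^sup>2\<close> norm of each argument by \<open>normal_derivative_bound\<close>, and
  periodic functions are limits of smooth periodic ones, for which it vanishes. The two arguments
  are approximated one after the other.
\<close>

lemma normal_derivative_periodic:
  fixes u v :: "'a::euclidean_space \<Rightarrow> real"
  assumes ne: "box a b \<noteq> {}" and u: "in_H2 (box a b) u" "periodic_bc a b u"
    and v: "in_H2 (box a b) v" "periodic_bc a b v"
  shows "normal_derivative (box a b) u v = 0"
proof -
  let ?\<Omega> = "box a b"
  have \<Omega>: "open ?\<Omega>" "bounded ?\<Omega>" by auto
  obtain w where w: "\<And>k. smooth (w k)" "\<And>k i x. i \<in> Basis \<Longrightarrow> w k (x + ((b - a) \<bullet> i) *\<^sub>R i) = w k x"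
    "(\<lambda>k. H2_norm ?\<Omega> (\<lambda>x. w k x - u x)) \<longlonglongrightarrow> 0"
    using u(2) unfolding periodic_bc_def by blast
  obtain z where z: "\<And>k. smooth (z k)" "\<And>k i x. i \<in> Basis \<Longrightarrow> z k (x + ((b - a) \<bullet> i) *\<^sub>R i) = z k x"
    "(\<lambda>k. H2_norm ?\<Omega> (\<lambda>x. z k x - v x)) \<longlonglongrightarrow> 0"
    using v(2) unfolding periodic_bc_def by blast
  have wH: "in_H2 ?\<Omega> (w k)" and zH: "in_H2 ?\<Omega> (z k)" for k
    using smooth_in_H2(1) \<Omega> w z by blast+
  have H1: "in_H2 ?\<Omega> f \<Longrightarrow> in_H1 ?\<Omega> f" for f by (simp add: in_H2_def)
  have wv: "normal_derivative ?\<Omega> (w k) v = 0" for k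
  proof (rule eq_0_if_abs_le_null_sequence[OF _ z(3)])
    fix l
    have "normal_derivative ?\<Omega> (w k) (\<lambda>x. 1 * z l x + (- 1) * v x)
        = 1 * normal_derivative ?\<Omega> (w k) (z l) + (- 1) * normal_derivative ?\<Omega> (w k) v"
      by (intro normal_derivative_lincomb_right \<Omega> wH H1 zH v)
    moreover have "normal_derivative ?\<Omega> (w k) (z l) = 0"
      using w z by (intro normal_derivative_smooth_periodic ne)
    ultimately have "\<bar>normal_derivative ?\<Omega> (w k) v\<bar> = \<bar>normal_derivative ?\<Omega> (w k) (\<lambda>x. z l x - v x)\<bar>"
      by simp
    also have "in_H2 ?\<Omega> (\<lambda>x. 1 * z l x + (- 1) * v x)"
      by (intro in_H2_lincomb(1) \<Omega> zH v)
    then have "\<bar>normal_derivative ?\<Omega> (w k) (\<lambda>x. z l x - v x)\<bar>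
        \<le> 2 * real DIM('a) * (H2_norm ?\<Omega> (w k) * H2_norm ?\<Omega> (\<lambda>x. z l x - v x))"
      by (intro normal_derivative_bound \<Omega> wH) simp
    finally show "\<bar>normal_derivative ?\<Omega> (w k) v\<bar>
        \<le> 2 * real DIM('a) * H2_norm ?\<Omega> (w k) * H2_norm ?\<Omega> (\<lambda>x. z l x - v x)"
      by (simp add: mult.assoc)
  qed
  show ?thesis
  proof (rule eq_0_if_abs_le_null_sequence[OF _ w(3)])
    fix k
    have "normal_derivative ?\<Omega> (\<lambda>x. 1 * w k x + (- 1) * u x) v
        = 1 * normal_derivative ?\<Omega> (w k) v + (- 1) * normal_derivative ?\<Omega> u v"
      by (intro normal_derivative_lincomb_left \<Omega> wH H1 u v)
    then have "\<bar>normal_derivative ?\<Omega> u v\<bar> = \<bar>normal_derivative ?\<Omega> (\<lambda>x. w k x - u x) v\<bar>"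
      by (simp add: wv)
    also have "in_H2 ?\<Omega> (\<lambda>x. 1 * w k x + (- 1) * u x)"
      by (intro in_H2_lincomb(1) \<Omega> wH u)
    then have "\<bar>normal_derivative ?\<Omega> (\<lambda>x. w k x - u x) v\<bar>
        \<le> 2 * real DIM('a) * (H2_norm ?\<Omega> (\<lambda>x. w k x - u x) * H2_norm ?\<Omega> v)"
      by (intro normal_derivative_bound \<Omega> v) simp
    finally show "\<bar>normal_derivative ?\<Omega> u v\<bar>
        \<le> 2 * real DIM('a) * H2_norm ?\<Omega> v * H2_norm ?\<Omega> (\<lambda>x. w k x - u x)"
      by (simp add: mult_ac)
  qed
qed

section \<open>The energy estimate\<close>

text \<open>
  Pair the first equation with \<open>d = u1 - u0\<close> and multiply the second by \<open>(R1 + R0) \<tau>\<close>. The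
  terms with \<open>G\<close> are the same in both, and so are the terms \<open>q \<theta>\<^sup>2 \<Delta>h\<close>, where
  \<open>q = (R1 + R0) / (2 Rh)\<close> and \<open>h = u0 + (\<rho> / 2) e\<close> with \<open>e = u0 - um\<close> is the extrapolated
  value. After adding, Green's formula leaves

    \<open>(\<beta> / \<tau>) \<parallel>d\<parallel>\<^sup>2 + (\<epsilon>\<^sup>2 / 2) (\<parallel>\<nabla>u1\<parallel>\<^sup>2 - \<parallel>\<nabla>u0\<parallel>\<^sup>2) - \<theta>\<^sup>2 (\<nabla>h, \<nabla>d) + R1\<^sup>2 - R0\<^sup>2 = 0\<close>.

  The explicit term is \<open>(\<nabla>h, \<nabla>d) = (\<nabla>u0, \<nabla>d) + (\<rho> / 2) (\<nabla>e, \<nabla>d)\<close>. Polarization of its first part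
  lowers \<open>\<epsilon>\<^sup>2\<close> to \<open>\<epsilon>\<^sup>2 - \<theta>\<^sup>2\<close> and produces \<open>(\<theta>\<^sup>2 / 2) \<parallel>\<nabla>d\<parallel>\<^sup>2\<close>; half of this absorbs
  the second part by Young's inequality.

  Here \<open>G\<close> stands for the nonlinear and the history term together, \<open>\<rho>\<close> for the ratio of the step
  sizes and \<open>\<beta>\<close> for the leading coefficient of the difference operator. The auxiliary functions in the proof are written as linear combinations with explicit
  coefficients, which is the form that the linearity lemmas rewrite.
\<close>

lemma energy_step:
  fixes u1 u0 um G :: "'a::euclidean_space \<Rightarrow> real"
    and R1 R0 Rh \<beta> \<tau> \<rho> \<epsilon> \<theta> :: real
  assumes \<Omega>: "open \<Omega>" and H2: "in_H2 \<Omega> u1" "in_H2 \<Omega> u0" "in_H2 \<Omega> um" and G: "in_L2 \<Omega> G"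
    and green: "\<And>v w. v \<in> {u1, u0, um} \<Longrightarrow> w \<in> {u1, u0} \<Longrightarrow> normal_derivative \<Omega> v w = 0"
    and \<tau>: "\<tau> > 0"
    and phi_eq: "AE x in lebesgue_on \<Omega>. \<beta> * ((u1 x - u0 x) / \<tau>)
        - \<epsilon>\<^sup>2 * (weak_laplacian \<Omega> (\<lambda>y. u1 y + u0 y) x / 2)
        + (1 - (R1 + R0) / (2 * Rh)) * \<theta>\<^sup>2 * weak_laplacian \<Omega> (\<lambda>y. u0 y + \<rho> / 2 * (u0 y - um y)) x
        + (R1 + R0) / (2 * Rh) * G x = 0"
    and R_eq: "(R1 - R0) / \<tau> = 1 / (2 * Rh) *
        L2_inner \<Omega> (\<lambda>x. - \<theta>\<^sup>2 * weak_laplacian \<Omega> (\<lambda>y. u0 y + \<rho> / 2 * (u0 y - um y)) x + G x)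
          (\<lambda>x. (u1 x - u0 x) / \<tau>)"
  shows "((\<epsilon>\<^sup>2 - \<theta>\<^sup>2) / 2 * (L2_norm \<Omega> (weak_grad \<Omega> u1))\<^sup>2
        + \<theta>\<^sup>2 / 4 * (L2_norm \<Omega> (weak_grad \<Omega> (\<lambda>x. u1 x - u0 x)))\<^sup>2 + \<bar>R1\<bar>\<^sup>2)
      - ((\<epsilon>\<^sup>2 - \<theta>\<^sup>2) / 2 * (L2_norm \<Omega> (weak_grad \<Omega> u0))\<^sup>2
        + \<theta>\<^sup>2 / 4 * \<rho>\<^sup>2 * (L2_norm \<Omega> (weak_grad \<Omega> (\<lambda>x. u0 x - um x)))\<^sup>2 + \<bar>R0\<bar>\<^sup>2)
      \<le> - (\<beta> / \<tau>) * (L2_norm \<Omega> (\<lambda>x. u1 x - u0 x))\<^sup>2"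
proof -
  define d where "d = (\<lambda>x. 1 * u1 x + (- 1) * u0 x)"
  define e where "e = (\<lambda>x. 1 * u0 x + (- 1) * um x)"
  define s where "s = (\<lambda>x. 1 * u1 x + 1 * u0 x)"
  define h where "h = (\<lambda>x. 1 * u0 x + (\<rho> / 2) * e x)"
  define q where "q = (R1 + R0) / (2 * Rh)"
  define P where "P f g = L2_inner \<Omega> (weak_grad \<Omega> f) (weak_grad \<Omega> g)" for f g
  have H: "in_H2 \<Omega> d" "in_H2 \<Omega> e" "in_H2 \<Omega> s" "in_H2 \<Omega> h"
    unfolding d_def e_def s_def h_def by (intro in_H2_lincomb(1) \<Omega> H2)+
  have H1: "in_H1 \<Omega> f" if "in_H2 \<Omega> f" for f using that by (simp add: in_H2_def)
  have dL2: "in_L2 \<Omega> d" using H1[OF H(1)] by (simp add: in_H1_def)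
  have lap: "in_L2 \<Omega> (weak_laplacian \<Omega> s)" "in_L2 \<Omega> (weak_laplacian \<Omega> h)"
    using H \<Omega> in_H2_laplacian_L2 by blast+
  have alt: "(\<lambda>x. u1 x - u0 x) = d" "(\<lambda>x. u0 x - um x) = e" "(\<lambda>y. u1 y + u0 y) = s"
    "(\<lambda>y. u0 y + \<rho> / 2 * (u0 y - um y)) = h"
    by (auto simp: d_def e_def s_def h_def)
  have d_at: "u1 x - u0 x = d x" for x by (simp add: d_def)
  have Bd: "normal_derivative \<Omega> f d = 0" if "f \<in> {u1, u0, um}" for f
    unfolding d_def
    by (subst normal_derivative_lincomb_right) (use that H2 H1 green \<Omega> in auto)
  have e0: "normal_derivative \<Omega> e d = 0"
    unfolding e_def by (subst normal_derivative_lincomb_left) (use H2 H H1 Bd \<Omega> in auto)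
  have s0: "normal_derivative \<Omega> s d = 0"
    unfolding s_def by (subst normal_derivative_lincomb_left) (use H2 H H1 Bd \<Omega> in auto)
  have h0: "normal_derivative \<Omega> h d = 0"
    unfolding h_def by (subst normal_derivative_lincomb_left) (use H2 H H1 Bd e0 \<Omega> in auto)
  have Ps: "L2_inner \<Omega> (weak_laplacian \<Omega> s) d = - P s d"
    and Ph: "L2_inner \<Omega> (weak_laplacian \<Omega> h) d = - P h d"
    using s0 h0 by (simp_all add: normal_derivative_def P_def)

  let ?N = "L2_inner \<Omega> G d"
  have id: "\<beta> / \<tau> * L2_inner \<Omega> d d + \<epsilon>\<^sup>2 / 2 * P s d - (1 - q) * \<theta>\<^sup>2 * P h d + q * ?N = 0"
  proof -
    let ?I = "integral\<^sup>L (lebesgue_on \<Omega>)"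
    have int: "integrable (lebesgue_on \<Omega>) (\<lambda>x. f x * d x)" if "in_L2 \<Omega> f" for f
      using that dL2 by (rule in_L2_mult_integrable)
    have "0 = ?I (\<lambda>x. \<beta> / \<tau> * (d x * d x) - \<epsilon>\<^sup>2 / 2 * (weak_laplacian \<Omega> s x * d x)
        + (1 - q) * \<theta>\<^sup>2 * (weak_laplacian \<Omega> h x * d x) + q * (G x * d x))"
    proof (rule integral_eq_zero_AE[symmetric])
      show "AE x in lebesgue_on \<Omega>. \<beta> / \<tau> * (d x * d x) - \<epsilon>\<^sup>2 / 2 * (weak_laplacian \<Omega> s x * d x)
        + (1 - q) * \<theta>\<^sup>2 * (weak_laplacian \<Omega> h x * d x) + q * (G x * d x) = 0"
        using phi_eq[unfolded alt d_at, folded q_def]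
      proof eventually_elim
        case (elim x)
        then have "(\<beta> * (d x / \<tau>) - \<epsilon>\<^sup>2 * (weak_laplacian \<Omega> s x / 2)
          + (1 - q) * \<theta>\<^sup>2 * weak_laplacian \<Omega> h x + q * G x) * d x = 0" by simp
        then show ?case by (simp add: algebra_simps)
      qed
    qed
    also have "\<dots> = \<beta> / \<tau> * L2_inner \<Omega> d d - \<epsilon>\<^sup>2 / 2 * L2_inner \<Omega> (weak_laplacian \<Omega> s) d
        + (1 - q) * \<theta>\<^sup>2 * L2_inner \<Omega> (weak_laplacian \<Omega> h) d + q * ?N"
      unfolding L2_inner_def inner_real_def using int[OF dL2] int[OF lap(1)] int[OF lap(2)] int[OF G]
      by simp
    finally show ?thesis by (simp add: Ps Ph)
  qed
  have R: "R1\<^sup>2 - R0\<^sup>2 = q * (\<theta>\<^sup>2 * P h d + ?N)"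
  proof -
    have "L2_inner \<Omega> (\<lambda>x. - \<theta>\<^sup>2 * weak_laplacian \<Omega> h x + G x) (\<lambda>x. d x / \<tau>)
        = L2_inner \<Omega> (\<lambda>x. - \<theta>\<^sup>2 * weak_laplacian \<Omega> h x + 1 * G x) d / \<tau>"
      by (simp add: L2_inner_def)
    also have "L2_inner \<Omega> (\<lambda>x. - \<theta>\<^sup>2 * weak_laplacian \<Omega> h x + 1 * G x) d = \<theta>\<^sup>2 * P h d + ?N"
      by (subst L2_inner_lincomb_left) (use lap G dL2 in \<open>auto simp: Ph intro: in_L2_mult_integrable\<close>)
    finally have "(R1 - R0) / \<tau> = 1 / (2 * Rh) * ((\<theta>\<^sup>2 * P h d + ?N) / \<tau>)"
      using R_eq[unfolded alt d_at] by simp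
    then have "(R1 - R0) / \<tau> * \<tau> = 1 / (2 * Rh) * ((\<theta>\<^sup>2 * P h d + ?N) / \<tau>) * \<tau>"
      by (simp only:)
    then have "R1 - R0 = 1 / (2 * Rh) * (\<theta>\<^sup>2 * P h d + ?N)"
      using \<tau> by simp
    then have "(R1 + R0) * (R1 - R0) = q * (\<theta>\<^sup>2 * P h d + ?N)"
      by (simp add: q_def)
    then show ?thesis by (simp add: power2_eq_square algebra_simps)
  qed

  have left: "P (\<lambda>x. a * f x + b * g x) k = a * P f k + b * P g k"
    if "in_H2 \<Omega> f" "in_H2 \<Omega> g" "in_H2 \<Omega> k" for a b f g k
    unfolding P_def using that by (intro L2_inner_grad_lincomb_left \<Omega> H1)
  have sym: "P f g = P g f" for f g
    unfolding P_def by (rule L2_inner_commute)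
  have Psd: "P s d = P u1 u1 - P u0 u0"
    using left[OF H2(1,2) H(1), of 1 1] left[OF H2(1,2) H2(1), of 1 "-1"] left[OF H2(1,2) H2(2), of 1 "-1"]
      sym[of u1 d] sym[of u0 d] sym[of u0 u1] unfolding s_def[symmetric] d_def[symmetric] by simp
  have Pdd: "P d d = P u1 u1 - P u0 u0 - 2 * P u0 d"
    using left[OF H2(1,2) H(1), of 1 "-1"] left[OF H2(1,2) H2(1), of 1 "-1"] left[OF H2(1,2) H2(2), of 1 "-1"]
      sym[of u1 d] sym[of u0 d] sym[of u0 u1] unfolding d_def[symmetric] by simp
  have Phd: "P h d = P u0 d + \<rho> / 2 * P e d"
    using left[OF H2(2) H(2) H(1), of 1 "\<rho> / 2"] unfolding h_def[symmetric] by simp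
  have young: "2 * \<rho> * P e d \<le> P d d + \<rho>\<^sup>2 * P e e"
  proof -
    define k where "k = (\<lambda>x. 1 * d x + (- \<rho>) * e x)"
    have k: "in_H2 \<Omega> k" unfolding k_def using H by (intro in_H2_lincomb(1) \<Omega>)
    have "P k k = P d d - 2 * \<rho> * P e d + \<rho>\<^sup>2 * P e e"
      using left[OF H(1,2) k, of 1 "- \<rho>"] left[OF H(1,2) H(1), of 1 "- \<rho>"] left[OF H(1,2) H(2), of 1 "- \<rho>"]
        sym[of d k] sym[of e k] sym[of d e]
      unfolding k_def[symmetric] by (simp add: power2_eq_square algebra_simps)
    moreover have "0 \<le> P k k" by (simp add: P_def L2_inner_def)
    ultimately show ?thesis by simp
  qed
  have "\<beta> / \<tau> * L2_inner \<Omega> d d + \<epsilon>\<^sup>2 / 2 * (P u1 u1 - P u0 u0) - \<theta>\<^sup>2 * P h d + (R1\<^sup>2 - R0\<^sup>2) = 0"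
    using id unfolding R Psd by (simp add: algebra_simps)
  moreover have "\<theta>\<^sup>2 * P h d = \<theta>\<^sup>2 / 2 * (P u1 u1 - P u0 u0 - P d d) + \<theta>\<^sup>2 / 4 * (2 * \<rho> * P e d)"
    unfolding Phd Pdd by (simp add: algebra_simps)
  moreover have "\<theta>\<^sup>2 / 4 * (2 * \<rho> * P e d) \<le> \<theta>\<^sup>2 / 4 * (P d d + \<rho>\<^sup>2 * P e e)"
    using young by (intro mult_left_mono) auto
  ultimately have "((\<epsilon>\<^sup>2 - \<theta>\<^sup>2) / 2 * P u1 u1 + \<theta>\<^sup>2 / 4 * P d d + R1\<^sup>2)
      - ((\<epsilon>\<^sup>2 - \<theta>\<^sup>2) / 2 * P u0 u0 + \<theta>\<^sup>2 / 4 * \<rho>\<^sup>2 * P e e + R0\<^sup>2) \<le> - (\<beta> / \<tau> * L2_inner \<Omega> d d)"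
    by (simp add: algebra_simps add_divide_distrib diff_divide_distrib)
  then show ?thesis
    unfolding L2_norm_power2 alt P_def by simp
qed

theorem theorem4p2:
  fixes \<Omega> :: "'a::euclidean_space set"
    and \<alpha> \<epsilon> \<theta> T :: real
    and F :: "real \<Rightarrow> real"
    and M :: int
    and t \<tau> :: "int \<Rightarrow> real"
    and \<phi> :: "int \<Rightarrow> 'a \<Rightarrow> real"
    and R :: "int \<Rightarrow> real"
  assumes dim: "DIM('a) \<in> {1, 2, 3}"
    and domain: "open \<Omega>" "connected \<Omega>" "bounded \<Omega>" "\<Omega> \<noteq> {}"
    and alpha: "0 < \<alpha>" "\<alpha> < 1"
    and theta: "\<theta>\<^sup>2 \<le> \<epsilon>\<^sup>2"
    and F_diff: "\<And>x. F differentiable (at x)"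
    and mesh: "1 \<le> M" "t 0 = 0" "\<And>n. n \<in> {0..M - 1} \<Longrightarrow> t n < t (n + 1)" "t M = T"
    and steps: "\<And>n. n \<in> {1..M} \<Longrightarrow> \<tau> n = t n - t (n - 1)"
    and step0: "\<tau> 0 > 0"
    and phi_H2: "\<And>n. n \<in> {-1..M} \<Longrightarrow> in_H2 \<Omega> (\<phi> n)"
    and boundary:
      "(\<exists>a b. \<Omega> = box a b \<and> (\<forall>n\<in>{-1..M}. periodic_bc a b (\<phi> n))) \<or>
       (\<forall>n\<in>{-1..M}. neumann_bc \<Omega> (\<phi> n))"
    and F'_L2: "\<And>n. n \<in> {0..M - 1} \<Longrightarrow> in_L2 \<Omega> (\<lambda>x. deriv F (extrap_fun \<tau> \<phi> n x))"
    and R_half: "\<And>n. n \<in> {0..M - 1} \<Longrightarrow> extrap \<tau> R n \<noteq> 0"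
    and scheme_phi: "\<And>n. n \<in> {0..M - 1} \<Longrightarrow> L1plus_CN_phi \<Omega> \<alpha> \<epsilon> \<theta> F t \<tau> \<phi> R n"
    and scheme_R: "\<And>n. n \<in> {0..M - 1} \<Longrightarrow> L1plus_CN_R \<Omega> \<alpha> \<theta> F t \<tau> \<phi> R n"
  shows "(\<forall>n\<in>{0..M - 1}.
      ((\<epsilon>\<^sup>2 - \<theta>\<^sup>2) / 2 * (L2_norm \<Omega> (weak_grad \<Omega> (\<phi> (n + 1))))\<^sup>2
        + \<theta>\<^sup>2 / 4 * (L2_norm \<Omega> (weak_grad \<Omega> (\<lambda>x. \<phi> (n + 1) x - \<phi> n x)))\<^sup>2
        + \<bar>R (n + 1)\<bar>\<^sup>2)
      - ((\<epsilon>\<^sup>2 - \<theta>\<^sup>2) / 2 * (L2_norm \<Omega> (weak_grad \<Omega> (\<phi> n)))\<^sup>2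
        + \<theta>\<^sup>2 / 4 * (\<tau> (n + 1) / \<tau> n)\<^sup>2
            * (L2_norm \<Omega> (weak_grad \<Omega> (\<lambda>x. \<phi> n x - \<phi> (n - 1) x)))\<^sup>2
        + \<bar>R n\<bar>\<^sup>2)
      \<le> - (bhat \<alpha> t \<tau> n 0 / \<tau> (n + 1)) * (L2_norm \<Omega> (\<lambda>x. \<phi> (n + 1) x - \<phi> n x))\<^sup>2
      \<and> - (bhat \<alpha> t \<tau> n 0 / \<tau> (n + 1)) * (L2_norm \<Omega> (\<lambda>x. \<phi> (n + 1) x - \<phi> n x))\<^sup>2 \<le> 0)
    \<and> ((\<forall>n\<in>{0..M - 1}. \<tau> (n + 1) = \<tau> n) \<or> \<theta> = 0 \<longrightarrow>
        (\<forall>n\<in>{0..M - 1}. discrete_energy \<Omega> \<epsilon> \<theta> \<phi> R (n + 1) \<le> discrete_energy \<Omega> \<epsilon> \<theta> \<phi> R n))"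
    (is "(\<forall>n\<in>_. ?E n \<le> ?D n \<and> ?D n \<le> 0) \<and> _")
proof -
  have \<tau>_pos: "\<tau> n > 0" if "n \<in> {0..M}" for n
  proof (cases "n = 0")
    case False
    with that have "n \<in> {1..M}" "n - 1 \<in> {0..M - 1}" by auto
    with steps[of n] mesh(3)[of "n - 1"] show ?thesis by simp
  qed (use step0 in simp)
  have green: "normal_derivative \<Omega> (\<phi> m) (\<phi> l) = 0" if "m \<in> {-1..M}" "l \<in> {-1..M}" for m l
    using boundary
  proof
    assume "\<exists>a b. \<Omega> = box a b \<and> (\<forall>n\<in>{-1..M}. periodic_bc a b (\<phi> n))"
    then obtain a b where "\<Omega> = box a b" "\<forall>n\<in>{-1..M}. periodic_bc a b (\<phi> n)" by blast
    with that phi_H2 domain(4) show ?thesis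
      using normal_derivative_periodic[of a b "\<phi> m" "\<phi> l"] by simp
  next
    assume "\<forall>n\<in>{-1..M}. neumann_bc \<Omega> (\<phi> n)"
    with that phi_H2[of l] show ?thesis by (simp add: neumann_bc_def in_H2_def)
  qed
  have phi_L2: "in_L2 \<Omega> (\<phi> n)" if "n \<in> {-1..M}" for n
    using phi_H2[OF that] by (simp add: in_H2_def in_H1_def)
  have step: "?E n \<le> ?D n" if n: "n \<in> {0..M - 1}" for n
  proof (rule energy_step[where Rh = "extrap \<tau> R n"
        and G = "\<lambda>x. deriv F (extrap_fun \<tau> \<phi> n x) + L1plus_history \<alpha> t \<tau> (\<lambda>m. \<phi> m x) n"])
    have idx: "n + 1 \<in> {-1..M}" "n \<in> {-1..M}" "n - 1 \<in> {-1..M}" using n by auto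
    show "in_H2 \<Omega> (\<phi> (n + 1))" "in_H2 \<Omega> (\<phi> n)" "in_H2 \<Omega> (\<phi> (n - 1))"
      using phi_H2 idx by blast+
    show "normal_derivative \<Omega> v w = 0"
      if "v \<in> {\<phi> (n + 1), \<phi> n, \<phi> (n - 1)}" "w \<in> {\<phi> (n + 1), \<phi> n}" for v w
      using that green idx by blast
    have "in_L2 \<Omega> (\<lambda>x. (bhat \<alpha> t \<tau> n (n - k) / \<tau> (k + 1)) * (\<phi> (k + 1) x - \<phi> k x))"
      if "k \<in> {0..n - 1}" for k
      using that n by (intro in_L2_scale in_L2_diff phi_L2) auto
    then have "in_L2 \<Omega> (\<lambda>x. L1plus_history \<alpha> t \<tau> (\<lambda>m. \<phi> m x) n)"
      unfolding L1plus_history_def by (intro in_L2_sum) simp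
    with F'_L2[OF n] show "in_L2 \<Omega> (\<lambda>x. deriv F (extrap_fun \<tau> \<phi> n x)
        + L1plus_history \<alpha> t \<tau> (\<lambda>m. \<phi> m x) n)"
      by (rule in_L2_add)
    show "\<tau> (n + 1) > 0" using \<tau>_pos[of "n + 1"] n by simp
    have half: "extrap_fun \<tau> \<phi> n = (\<lambda>y. \<phi> n y + \<tau> (n + 1) / \<tau> n / 2 * (\<phi> n y - \<phi> (n - 1) y))"
      by (simp add: fun_eq_iff extrap_fun_def extrap_def mult.commute)
    show "AE x in lebesgue_on \<Omega>. bhat \<alpha> t \<tau> n 0 * ((\<phi> (n + 1) x - \<phi> n x) / \<tau> (n + 1))
        - \<epsilon>\<^sup>2 * (weak_laplacian \<Omega> (\<lambda>y. \<phi> (n + 1) y + \<phi> n y) x / 2)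
        + (1 - (R (n + 1) + R n) / (2 * extrap \<tau> R n)) * \<theta>\<^sup>2
          * weak_laplacian \<Omega> (\<lambda>y. \<phi> n y + \<tau> (n + 1) / \<tau> n / 2 * (\<phi> n y - \<phi> (n - 1) y)) x
        + (R (n + 1) + R n) / (2 * extrap \<tau> R n)
          * (deriv F (extrap_fun \<tau> \<phi> n x) + L1plus_history \<alpha> t \<tau> (\<lambda>m. \<phi> m x) n) = 0"
      using scheme_phi[OF n] unfolding L1plus_CN_phi_def L1plus_local_def half[symmetric] .
    show "(R (n + 1) - R n) / \<tau> (n + 1) = 1 / (2 * extrap \<tau> R n) *
        L2_inner \<Omega> (\<lambda>x. - \<theta>\<^sup>2 * weak_laplacian \<Omega>
            (\<lambda>y. \<phi> n y + \<tau> (n + 1) / \<tau> n / 2 * (\<phi> n y - \<phi> (n - 1) y)) x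
            + (deriv F (extrap_fun \<tau> \<phi> n x) + L1plus_history \<alpha> t \<tau> (\<lambda>m. \<phi> m x) n))
          (\<lambda>x. (\<phi> (n + 1) x - \<phi> n x) / \<tau> (n + 1))"
      using scheme_R[OF n] unfolding L1plus_CN_R_def half[symmetric] add.assoc .
  qed (rule domain(1))
  have dissip: "?D n \<le> 0" if "n \<in> {0..M - 1}" for n
  proof -
    have "0 \<le> bhat \<alpha> t \<tau> n 0"
      using alpha Gamma_real_pos[of "3 - \<alpha>"] by (simp add: bhat_def)
    moreover have "0 < \<tau> (n + 1)" using \<tau>_pos[of "n + 1"] that by simp
    ultimately show ?thesis by simp
  qed
  have "discrete_energy \<Omega> \<epsilon> \<theta> \<phi> R (n + 1) \<le> discrete_energy \<Omega> \<epsilon> \<theta> \<phi> R n"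
    if "(\<forall>n\<in>{0..M - 1}. \<tau> (n + 1) = \<tau> n) \<or> \<theta> = 0" and n: "n \<in> {0..M - 1}" for n
  proof -
    have "\<theta>\<^sup>2 / 4 * (\<tau> (n + 1) / \<tau> n)\<^sup>2 = \<theta>\<^sup>2 / 4"
      using that \<tau>_pos[of n] by auto
    with step[OF n] dissip[OF n] show ?thesis
      unfolding discrete_energy_def add_diff_cancel_right' by (simp only:)
  qed
  with step dissip show ?thesis by blast
qed

end
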